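(* Let $s = \left\{\begin{array}{ccc} \mathbb A & \mathbb B & \mathbb C\\ \mathbb F & \mathbb E & \mathbb D\end{array}\right\}$, let $p_s:\mathcal H \dashrightarrow (\mathbb P^2)^*$ be the associated Pascal rational map, and let $\Omega_s\subseteq\mathcal H$ be its indeterminacy scheme. Then the scheme $\Omega_s$ is equal to the union $\bigcup \Delta_\pi$, where $\pi$ ranges over the following six partitions of $\{\mathbb A,\mathbb B,\mathbb C,\mathbb D,\mathbb E,\mathbb F\}$: \[ \vartheta_1=\mathbb A\mathbb B\mathbb C.\mathbb D.\mathbb E.\mathbb F,\quad \vartheta_2=\mathbb A.\mathbb B.\mathbb C.\mathbb D\mathbb E\mathbb F,\quad \vartheta_3=\mathbb A\mathbb B.\mathbb C.\mathbb D.\mathbb E\mathbb F,\] \[ \vartheta_4=\mathbb A.\mathbb B\mathbb C.\mathbb D\mathbb E.\mathbb F,\quad \vartheta_5=\mathbb A\mathbb C.\mathbb B.\mathbb D\mathbb F.\mathbb E,\quad \vartheta_6=\mathbb A\mathbb F.\mathbb B\mathbb E.\mathbb C\mathbb D. \] In particular, $\Omega_s$ is a reduced scheme with six irreducible components.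
   Context: Work over the complex numbers. Let $\mathcal K\subseteq\mathbb P^2$ be the nonsingular conic $z_0z_2=z_1^2$, with the isomorphism $\tau:\mathbb P^1\to\mathcal K$, $\tau(a)=[1,a,a^2]$ for $a\in\mathbf C$, $\tau(\infty)=[0,0,1]$. The line $\alpha z_0+\beta z_1+\gamma z_2=0$ is written $\langle\alpha,\beta,\gamma\rangle\in(\mathbb P^2)^*$. Let $L=\{\mathbb A,\mathbb B,\mathbb C,\mathbb D,\mathbb E,\mathbb F\}$ be a set of six letters, and let $\mathcal H=\mathcal K^{L}$ be the variety of all maps $h:L\to\mathcal K$, so $\mathcal H\simeq(\mathbb P^1)^6$. Write $A=h(\mathbb A),\dots,F=h(\mathbb F)$. A partition of $L$ is written by separating its blocks by dots, e.g. $\mathbb A\mathbb C\mathbb D.\mathbb B.\mathbb E\mathbb F$. For a partition $\pi$ of $L$, the polydiagonal is the nonsingular closed subvariety $\Delta_\pi=\{h\in\mathcal H: h(x)=h(y)\text{ whenever }x,y\text{ belong to the same block of }\pi\}$ (with its reduced structure). A union of closed subschemes is the subscheme defined by the intersection of the ideal sheaves. By Pascal's theorem, for pairwise distinct points $A,\dots,F\in\mathcal K$ the three points $AE\cap BF$, $AD\cap CF$, $BD\cap CE$ are collinear; the line containing them is the Pascal line. The rational map $p_s:\mathcal H\dashrightarrow(\mathbb P^2)^*$ sends $h$ to the Pascal line. On the affine chart $A=\tau(a),\dots,F=\tau(f)$ with coordinate ring $\mathbf C[a,b,c,d,e,f]$ it is given by $\langle u_0,u_1,u_2\rangle$ where \[u_0=abde-abdf-acde+acef+bcdf-bcef,\]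 \[u_1=-abe+abf+acd-acf+adf-aef-bcd+bce-bde+bef+cde-cdf,\] \[u_2=-ad+ae+bd-bf-ce+cf.\] The indeterminacy scheme (scheme of base points) $\Omega_s$ of $p_s$ is the closed subscheme of $\mathcal H$ which is locally defined by the ideal generated by the three components of $p_s$, when $p_s$ is written locally as a projective triple of regular functions without common non-unit factor; on the affine chart above it is defined by the ideal $(u_0,u_1,u_2)$. Globally it is the common zero scheme in $(\mathbb P^1)^6$ of the three forms of multidegree $(1,1,1,1,1,1)$ obtained by multihomogenizing $u_0,u_1,u_2$. *)

theory Defs
  imports "HOL-Analysis.Analysis" "HOL-Library.Poly_Mapping"
begin

section \<open>The projective plane, the conic and the variety of sextuples\<close>

quotient_type p2 = "complex ^ 3" / partial: "\<lambda>v w. v \<noteq> 0 \<and> (\<exists>c. c \<noteq> 0 \<and> w = c *s v)"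
proof (rule part_equivpI)
  show "\<exists>x::complex^3. x \<noteq> 0 \<and> (\<exists>c. c \<noteq> 0 \<and> x = c *s x)"
    by (rule exI[of _ "axis 1 1"]) (auto intro!: exI[of _ 1] simp: axis_eq_0_iff)
  show "symp (\<lambda>v w. v \<noteq> (0::complex^3) \<and> (\<exists>c. c \<noteq> 0 \<and> w = c *s v))"
  proof (rule sympI)
    fix v w :: "complex^3"
    assume "v \<noteq> 0 \<and> (\<exists>c. c \<noteq> 0 \<and> w = c *s v)"
    then obtain c where "v \<noteq> 0" "c \<noteq> 0" "w = c *s v" by blast
    then show "w \<noteq> 0 \<and> (\<exists>c. c \<noteq> 0 \<and> v = c *s w)"
      by (auto intro!: exI[of _ "inverse c"])
  qed
  show "transp (\<lambda>v w. v \<noteq> (0::complex^3) \<and> (\<exists>c. c \<noteq> 0 \<and> w = c *s v))"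
  proof (rule transpI)
    fix u v w :: "complex^3"
    assume "u \<noteq> 0 \<and> (\<exists>c. c \<noteq> 0 \<and> v = c *s u)" "v \<noteq> 0 \<and> (\<exists>c. c \<noteq> 0 \<and> w = c *s v)"
    then obtain c d where "u \<noteq> 0" "c \<noteq> 0" "v = c *s u" "d \<noteq> 0" "w = d *s v" by blast
    then show "u \<noteq> 0 \<and> (\<exists>c. c \<noteq> 0 \<and> w = c *s u)"
      by (auto intro!: exI[of _ "d * c"])
  qed
qed

text \<open>The homogeneous coordinates \<open>z\<^sub>0, z\<^sub>1, z\<^sub>2\<close> are the components 1, 2, 3.\<close>

lift_definition on_conic :: "p2 \<Rightarrow> bool" is "\<lambda>z. z $ 1 * z $ 3 = (z $ 2)\<^sup>2"
  by (auto simp: power2_eq_square)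

text \<open>Lines, that is, points of the dual plane, are again represented by \<^typ>\<open>p2\<close>.\<close>

lift_definition incident :: "p2 \<Rightarrow> p2 \<Rightarrow> bool" is "\<lambda>u z. (\<Sum>i\<in>UNIV. u $ i * z $ i) = 0"
proof -
  fix u u' z z' :: "complex^3"
  assume "u \<noteq> 0 \<and> (\<exists>c. c \<noteq> 0 \<and> u' = c *s u)" "z \<noteq> 0 \<and> (\<exists>c. c \<noteq> 0 \<and> z' = c *s z)"
  then obtain c d where cd: "c \<noteq> 0" "u' = c *s u" "d \<noteq> 0" "z' = d *s z" by blast
  have "(\<Sum>i\<in>UNIV. u' $ i * z' $ i) = (c * d) * (\<Sum>i\<in>UNIV. u $ i * z $ i)"
    by (simp add: cd sum_distrib_left mult_ac)
  then show "((\<Sum>i\<in>UNIV. u $ i * z $ i) = 0) = ((\<Sum>i\<in>UNIV. u' $ i * z' $ i) = 0)"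
    using cd by simp
qed

datatype letter = LA | LB | LC | LD | LE | LF

definition sextuples :: "(letter \<Rightarrow> p2) set" where
  "sextuples = {h. \<forall>l. on_conic (h l)}"

definition polydiagonal :: "letter set set \<Rightarrow> (letter \<Rightarrow> p2) set" where
  "polydiagonal \<pi> = {h \<in> sextuples. \<forall>B\<in>\<pi>. \<forall>x\<in>B. \<forall>y\<in>B. h x = h y}"

definition collinear3 :: "p2 \<Rightarrow> p2 \<Rightarrow> p2 \<Rightarrow> bool" where
  "collinear3 X P Q \<longleftrightarrow> (\<exists>u. incident u X \<and> incident u P \<and> incident u Q)"

text \<open>The array with rows \<open>ABC\<close> and \<open>FED\<close> has the cross-hair points
  \<open>AE.BF\<close>, \<open>AD.CF\<close> and \<open>BD.CE\<close>. This is only meaningful for injective \<open>h\<close>.\<close>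

definition pascal_map :: "(letter \<Rightarrow> p2) \<Rightarrow> p2" where
  "pascal_map h = (THE u.
     (\<forall>X. collinear3 X (h LA) (h LE) \<and> collinear3 X (h LB) (h LF) \<longrightarrow> incident u X) \<and>
     (\<forall>X. collinear3 X (h LA) (h LD) \<and> collinear3 X (h LC) (h LF) \<longrightarrow> incident u X) \<and>
     (\<forall>X. collinear3 X (h LB) (h LD) \<and> collinear3 X (h LC) (h LE) \<longrightarrow> incident u X))"


section \<open>Polynomials and affine charts\<close>

type_synonym 'v cpoly = "('v \<Rightarrow>\<^sub>0 nat) \<Rightarrow>\<^sub>0 complex"

definition Var :: "'v \<Rightarrow> 'v cpoly" where
  "Var v = Poly_Mapping.single (Poly_Mapping.single v 1) 1"

definition subst_poly :: "(complex \<Rightarrow> 'a) \<Rightarrow> ('v \<Rightarrow> 'a) \<Rightarrow> 'v cpoly \<Rightarrow> 'a::comm_ring_1" where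
  "subst_poly c x p =
     (\<Sum>m\<in>Poly_Mapping.keys p. c (Poly_Mapping.lookup p m) *
        (\<Prod>v\<in>Poly_Mapping.keys m. x v ^ Poly_Mapping.lookup m v))"

definition eval_poly :: "('v \<Rightarrow> complex) \<Rightarrow> 'v cpoly \<Rightarrow> complex" where
  "eval_poly = subst_poly (\<lambda>c. c)"

text \<open>The conic is covered by the charts \<open>a \<mapsto> \<tau>(a) = [1, a, a\<^sup>2]\<close> (index \<^const>\<open>False\<close>) and
  \<open>a \<mapsto> \<tau>(1/a) = [a\<^sup>2, a, 1]\<close> (index \<^const>\<open>True\<close>; here \<open>a = 0\<close> gives \<open>\<tau>(\<infinity>)\<close>). A choice of one of
  them for each letter gives an open affine subset of \<^const>\<open>sextuples\<close> with coordinate ring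
  \<^typ>\<open>letter cpoly\<close>, and these 64 subsets cover it.\<close>

type_synonym chart = "letter \<Rightarrow> bool"

definition conic_point :: "bool \<Rightarrow> complex \<Rightarrow> p2" where
  "conic_point b a = abs_p2 (if b then vector [a\<^sup>2, a, 1] else vector [1, a, a\<^sup>2])"

definition chart_map :: "chart \<Rightarrow> (letter \<Rightarrow> complex) \<Rightarrow> (letter \<Rightarrow> p2)" where
  "chart_map \<sigma> x = (\<lambda>l. conic_point (\<sigma> l) (x l))"


section \<open>Closed subschemes\<close>

text \<open>A closed subscheme is represented by its ideals in the coordinate rings of the 64 affine
  charts. The ideals have to agree on overlaps: on the overlap of \<open>\<sigma>\<close> and \<open>\<tau>\<close> the coordinates of
  the letters in \<open>D\<close> are inverted, and a section \<open>f\<close> over \<open>\<sigma>\<close> becomes \<open>g / (\<Prod>l\<in>D. y\<^sub>l)\<^sup>N\<close>.\<close>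

type_synonym subscheme = "chart \<Rightarrow> letter cpoly set"

definition closed_subscheme :: "subscheme \<Rightarrow> bool" where
  "closed_subscheme I \<longleftrightarrow>
     (\<forall>\<sigma>. module.subspace (*) (I \<sigma>)) \<and>
     (\<forall>\<sigma> \<tau> f g N. let D = {l. \<sigma> l \<noteq> \<tau> l} in
        f \<in> I \<sigma> \<longrightarrow>
        (\<forall>y. (\<forall>l\<in>D. y l \<noteq> 0) \<longrightarrow>
           eval_poly y g = (\<Prod>l\<in>D. y l) ^ N *
             eval_poly (\<lambda>l. if l \<in> D then inverse (y l) else y l) f) \<longrightarrow>
        (\<exists>M. (\<Prod>l\<in>D. Var l) ^ M * g \<in> I \<tau>))"

definition reduced_structure :: "(letter \<Rightarrow> p2) set \<Rightarrow> subscheme" where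
  "reduced_structure Z \<sigma> = {f. \<forall>x. chart_map \<sigma> x \<in> Z \<longrightarrow> eval_poly x f = 0}"

definition scheme_union :: "subscheme set \<Rightarrow> subscheme" where
  "scheme_union \<Z> \<sigma> = (\<Inter>I\<in>\<Z>. I \<sigma>)"

definition reduced_scheme :: "subscheme \<Rightarrow> bool" where
  "reduced_scheme I \<longleftrightarrow> (\<forall>\<sigma> f n. f ^ n \<in> I \<sigma> \<longrightarrow> f \<in> I \<sigma>)"

definition support :: "subscheme \<Rightarrow> (letter \<Rightarrow> p2) set" where
  "support I = {chart_map \<sigma> x | \<sigma> x. \<forall>f\<in>I \<sigma>. eval_poly x f = 0}"

text \<open>The topology of the variety of sextuples. Irreducible components of a closed subscheme of
  a complex variety may be computed on its closed points.\<close>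

definition zariski_closed :: "(letter \<Rightarrow> p2) set \<Rightarrow> bool" where
  "zariski_closed C \<longleftrightarrow> C \<subseteq> sextuples \<and>
     (\<forall>\<sigma>. \<exists>P. {x. chart_map \<sigma> x \<in> C} = {x. \<forall>p\<in>P. eval_poly x p = 0})"

definition zariski :: "(letter \<Rightarrow> p2) topology" where
  "zariski = topology (\<lambda>U. U \<subseteq> sextuples \<and> zariski_closed (sextuples - U))"

definition irreducible_space :: "'a topology \<Rightarrow> bool" where
  "irreducible_space X \<longleftrightarrow> topspace X \<noteq> {} \<and>
     (\<forall>C D. closedin X C \<and> closedin X D \<and> C \<union> D = topspace X \<longrightarrow> C = topspace X \<or> D = topspace X)"

definition irreducible_components :: "'a topology \<Rightarrow> 'a set set" where
  "irreducible_components X =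
     {C. C \<subseteq> topspace X \<and> irreducible_space (subtopology X C) \<and>
         (\<forall>C'. C \<subseteq> C' \<and> C' \<subseteq> topspace X \<and> irreducible_space (subtopology X C') \<longrightarrow> C' = C)}"


section \<open>The scheme of base points\<close>

text \<open>Homogeneous coordinates \<open>[s, t]\<close> (constructors \<open>HS\<close>, \<open>HT\<close>) on each factor of the sixfold product of the projective line, with affine
  coordinate \<open>t/s\<close>; a form is restricted to a chart by setting one of \<open>s, t\<close> to 1.\<close>

datatype hcoord = HS letter | HT letter

definition multihomogenize :: "(letter \<Rightarrow> nat) \<Rightarrow> letter cpoly \<Rightarrow> hcoord cpoly" where
  "multihomogenize d p =
     (\<Sum>m\<in>Poly_Mapping.keys p. Poly_Mapping.single
        (\<Sum>l\<in>UNIV. Poly_Mapping.single (HT l) (Poly_Mapping.lookup m l) +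
                  Poly_Mapping.single (HS l) (d l - Poly_Mapping.lookup m l))
        (Poly_Mapping.lookup p m))"

definition chart_coord :: "chart \<Rightarrow> hcoord \<Rightarrow> letter cpoly" where
  "chart_coord \<sigma> v = (case v of HS l \<Rightarrow> if \<sigma> l then Var l else 1
                              | HT l \<Rightarrow> if \<sigma> l then 1 else Var l)"

definition dehomogenize :: "chart \<Rightarrow> hcoord cpoly \<Rightarrow> letter cpoly" where
  "dehomogenize \<sigma> = subst_poly (Poly_Mapping.single 0) (chart_coord \<sigma>)"

definition common_zero_scheme :: "hcoord cpoly set \<Rightarrow> subscheme" where
  "common_zero_scheme F \<sigma> = module.span (*) (dehomogenize \<sigma> ` F)"

definition u0 :: "letter cpoly" where
  "u0 = (let a = Var LA; b = Var LB; c = Var LC; d = Var LD; e = Var LE; f = Var LF in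
     a*b*d*e - a*b*d*f - a*c*d*e + a*c*e*f + b*c*d*f - b*c*e*f)"

definition u1 :: "letter cpoly" where
  "u1 = (let a = Var LA; b = Var LB; c = Var LC; d = Var LD; e = Var LE; f = Var LF in
     - a*b*e + a*b*f + a*c*d - a*c*f + a*d*f - a*e*f - b*c*d + b*c*e - b*d*e + b*e*f + c*d*e - c*d*f)"

definition u2 :: "letter cpoly" where
  "u2 = (let a = Var LA; b = Var LB; c = Var LC; d = Var LD; e = Var LE; f = Var LF in
     - a*d + a*e + b*d - b*f - c*e + c*f)"

definition pascal_forms :: "hcoord cpoly set" where
  "pascal_forms = multihomogenize (\<lambda>_. 1) ` {u0, u1, u2}"

definition indeterminacy_scheme :: subscheme where
  "indeterminacy_scheme = common_zero_scheme pascal_forms"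


section \<open>Basic facts\<close>

lemma cpoly_expand: "p = (\<Sum>m\<in>Poly_Mapping.keys p. Poly_Mapping.single m (Poly_Mapping.lookup p m))"
  by (rule poly_mapping_eqI) (auto simp: lookup_sum lookup_single when_def sum.If_cases in_keys_iff)

lemma monomial_superset:
  fixes x :: "'v \<Rightarrow> 'a::comm_ring_1"
  assumes "finite S" "Poly_Mapping.keys m \<subseteq> S"
  shows "(\<Prod>v\<in>Poly_Mapping.keys m. x v ^ Poly_Mapping.lookup m v) = (\<Prod>v\<in>S. x v ^ Poly_Mapping.lookup m v)"
  using assms by (intro prod.mono_neutral_left) (auto simp: in_keys_iff)

lemma monomial_add:
  fixes x :: "'v \<Rightarrow> 'a::comm_ring_1"
  shows "(\<Prod>v\<in>Poly_Mapping.keys (m + n). x v ^ Poly_Mapping.lookup (m + n) v) =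
    (\<Prod>v\<in>Poly_Mapping.keys m. x v ^ Poly_Mapping.lookup m v) * (\<Prod>v\<in>Poly_Mapping.keys n. x v ^ Poly_Mapping.lookup n v)"
proof -
  let ?S = "Poly_Mapping.keys m \<union> Poly_Mapping.keys n"
  have "Poly_Mapping.keys (m + n) \<subseteq> ?S" by (rule keys_add)
  then have "(\<Prod>v\<in>Poly_Mapping.keys (m + n). x v ^ Poly_Mapping.lookup (m + n) v) = (\<Prod>v\<in>?S. x v ^ Poly_Mapping.lookup (m + n) v)"
    by (intro monomial_superset) auto
  also have "\<dots> = (\<Prod>v\<in>?S. x v ^ Poly_Mapping.lookup m v) * (\<Prod>v\<in>?S. x v ^ Poly_Mapping.lookup n v)"
    by (simp add: lookup_add power_add prod.distrib)
  finally show ?thesis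
    using monomial_superset[of ?S m x] monomial_superset[of ?S n x] by simp
qed

lemma subst_poly_superset:
  assumes "c 0 = 0" "finite S" "Poly_Mapping.keys p \<subseteq> S"
  shows "subst_poly c x p = (\<Sum>m\<in>S. c (Poly_Mapping.lookup p m) *
        (\<Prod>v\<in>Poly_Mapping.keys m. x v ^ Poly_Mapping.lookup m v))"
  unfolding subst_poly_def
  using assms by (intro sum.mono_neutral_left) (auto simp: in_keys_iff)

lemma subst_poly_single:
  assumes "c 0 = 0"
  shows "subst_poly c x (Poly_Mapping.single m k) = c k * (\<Prod>v\<in>Poly_Mapping.keys m. x v ^ Poly_Mapping.lookup m v)"
  by (subst subst_poly_superset[of c "{m}"]) (auto simp: assms)

lemma subst_poly_zero: "subst_poly c x 0 = 0"
  by (simp add: subst_poly_def)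

lemma subst_poly_add:
  assumes "c 0 = 0" "\<And>a b. c (a + b) = c a + c b"
  shows "subst_poly c x (p + q) = subst_poly c x p + subst_poly c x q"
proof -
  let ?S = "Poly_Mapping.keys p \<union> Poly_Mapping.keys q"
  have "Poly_Mapping.keys (p + q) \<subseteq> ?S" by (rule keys_add)
  then show ?thesis
    by (simp add: subst_poly_superset[of c ?S] assms lookup_add algebra_simps sum.distrib)
qed

lemma subst_poly_sum:
  assumes "c 0 = 0" "\<And>a b. c (a + b) = c a + c b"
  shows "subst_poly c x (sum g A) = (\<Sum>a\<in>A. subst_poly c x (g a))"
  by (induction A rule: infinite_finite_induct) (auto simp: subst_poly_zero subst_poly_add[of c, OF assms])

lemma subst_poly_mult:
  assumes c: "c 0 = 0" "\<And>a b. c (a + b) = c a + c b" "\<And>a b. c (a * b) = c a * c b"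
  shows "subst_poly c x (p * q) = subst_poly c x p * subst_poly c x q"
proof -
  have "p * q = (\<Sum>m\<in>Poly_Mapping.keys p. \<Sum>n\<in>Poly_Mapping.keys q.
      Poly_Mapping.single (m + n) (Poly_Mapping.lookup p m * Poly_Mapping.lookup q n))"
    by (subst cpoly_expand[of p], subst cpoly_expand[of q]) (simp add: sum_product mult_single)
  then show ?thesis
    by (simp add: subst_poly_sum[of c, OF c(1,2)] subst_poly_single[of c, OF c(1)] c(3) monomial_add)
       (simp add: subst_poly_def sum_product mult_ac)
qed

lemma eval_poly_simps [simp]:
  "eval_poly x 0 = 0" "eval_poly x 1 = 1"
  "eval_poly x (p + q) = eval_poly x p + eval_poly x q"
  "eval_poly x (p * q) = eval_poly x p * eval_poly x q"
  "eval_poly x (Var v) = x v"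
  "eval_poly x (Poly_Mapping.single m k) = k * (\<Prod>v\<in>Poly_Mapping.keys m. x v ^ Poly_Mapping.lookup m v)"
  "eval_poly x (sum g A) = (\<Sum>a\<in>A. eval_poly x (g a))"
  using subst_poly_single[of "\<lambda>c. c" x 0 1]
  by (simp_all add: eval_poly_def subst_poly_zero subst_poly_add subst_poly_mult subst_poly_single
      subst_poly_sum Var_def)

lemma eval_poly_minus [simp]:
  "eval_poly x (- p) = - eval_poly x p" "eval_poly x (p - q) = eval_poly x p - eval_poly x q"
proof -
  have *: "eval_poly x (- p) = - eval_poly x p" for p
    using eval_poly_simps(3)[of x p "- p"] by (simp add: eq_neg_iff_add_eq_0 add.commute del: eval_poly_simps(3))
  show "eval_poly x (- p) = - eval_poly x p" by (rule *)
  show "eval_poly x (p - q) = eval_poly x p - eval_poly x q"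
    using eval_poly_simps(3)[of x p "- q"] * by simp
qed

lemma eval_poly_power [simp]: "eval_poly x (p ^ n) = eval_poly x p ^ n"
  by (induction n) auto

lemma eval_poly_prod [simp]: "eval_poly x (prod g A) = (\<Prod>a\<in>A. eval_poly x (g a))"
  by (induction A rule: infinite_finite_induct) auto

lemma letter_UNIV: "(UNIV :: letter set) = {LA, LB, LC, LD, LE, LF}"
  using letter.exhaust by auto

instance letter :: finite
  by standard (simp add: letter_UNIV)

lemma hcoord_UNIV: "(UNIV :: hcoord set) = HS ` UNIV \<union> HT ` UNIV"
proof -
  have "v \<in> range HS \<union> range HT" for v by (cases v) auto
  then show ?thesis by auto
qed

instance hcoord :: finite
  by standard (simp add: hcoord_UNIV)

lemma eval_dehomogenize:
  "eval_poly x (dehomogenize \<sigma> F) = eval_poly (\<lambda>v. eval_poly x (chart_coord \<sigma> v)) F"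
proof -
  have "eval_poly x (subst_poly (Poly_Mapping.single 0) y F) = eval_poly (\<lambda>v. eval_poly x (y v)) F" for y
    unfolding subst_poly_def by (simp add: fun_cong[OF fun_cong[OF eval_poly_def], of "\<lambda>v. eval_poly x (y v)"] subst_poly_def)
  then show ?thesis by (simp add: dehomogenize_def)
qed

lemma eval_poly_alt:
  fixes x :: "'v::finite \<Rightarrow> complex"
  shows "eval_poly x p = (\<Sum>m\<in>Poly_Mapping.keys p. Poly_Mapping.lookup p m * (\<Prod>v\<in>UNIV. x v ^ Poly_Mapping.lookup m v))"
  by (simp add: eval_poly_def subst_poly_def monomial_superset[of UNIV])

text \<open>Value of the multihomogenization, as a function on the affine cone.\<close>
lemma eval_multihomogenize:
  "eval_poly z (multihomogenize d p) =
     (\<Sum>m\<in>Poly_Mapping.keys p. Poly_Mapping.lookup p m *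
        (\<Prod>l\<in>UNIV. z (HT l) ^ Poly_Mapping.lookup m l * z (HS l) ^ (d l - Poly_Mapping.lookup m l)))"
proof -
  have 1: "eval_poly z (Poly_Mapping.single (\<Sum>l\<in>A. M l) 1) = (\<Prod>l\<in>A. eval_poly z (Poly_Mapping.single (M l) 1))"
    for A :: "letter set" and M
  proof (induction A rule: infinite_finite_induct)
    case (insert a A)
    have "Poly_Mapping.single (M a + sum M A) (1::complex) = Poly_Mapping.single (M a) 1 * Poly_Mapping.single (sum M A) 1"
      by (simp add: mult_single)
    with insert show ?case by (simp del: eval_poly_simps(6))
  qed auto
  have 2: "eval_poly z (Poly_Mapping.single m k) = k * eval_poly z (Poly_Mapping.single m 1)" for m k
    by simp
  have 3: "eval_poly z (Poly_Mapping.single (Poly_Mapping.single v n) 1) = z v ^ n" for v n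
    by (cases "n = 0") auto
  have 4: "eval_poly z (Poly_Mapping.single (m + n) 1) =
     eval_poly z (Poly_Mapping.single m 1) * eval_poly z (Poly_Mapping.single n 1)" for m n
    by (simp add: monomial_add)
  show ?thesis
    unfolding multihomogenize_def eval_poly_simps(7)
  proof (rule sum.cong[OF refl])
    fix m
    show "eval_poly z (Poly_Mapping.single (\<Sum>l\<in>UNIV. Poly_Mapping.single (HT l) (Poly_Mapping.lookup m l) +
                  Poly_Mapping.single (HS l) (d l - Poly_Mapping.lookup m l)) (Poly_Mapping.lookup p m)) =
      Poly_Mapping.lookup p m * (\<Prod>l\<in>UNIV. z (HT l) ^ Poly_Mapping.lookup m l * z (HS l) ^ (d l - Poly_Mapping.lookup m l))"
      by (subst 2) (simp only: 1 4 3)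
  qed
qed


lemma chart_map_in_sextuples: "chart_map \<sigma> x \<in> sextuples"
proof -
  have "on_conic (conic_point b a)" for b a
  proof -
    have *: "on_conic (abs_p2 v)" if "v \<noteq> 0" "v $ 1 * v $ 3 = (v $ 2)\<^sup>2" for v
    proof -
      have "v = 1 *s v" by simp
      with that show ?thesis by (subst on_conic.abs_eq) (auto intro!: exI[of _ "1::complex"])
    qed
    show ?thesis
      unfolding conic_point_def
      by (rule *) (auto simp: vec_eq_iff forall_3 power2_eq_square)
  qed
  then show ?thesis by (simp add: chart_map_def sextuples_def)
qed

lemma zariski_closed_Int:
  assumes "\<And>C. C \<in> \<C> \<Longrightarrow> zariski_closed C"
  shows "zariski_closed (sextuples \<inter> \<Inter>\<C>)"
  unfolding zariski_closed_def
proof (intro conjI allI)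
  fix \<sigma>
  from assms have "\<forall>C\<in>\<C>. \<exists>P. {x. chart_map \<sigma> x \<in> C} = {x. \<forall>p\<in>P. eval_poly x p = 0}"
    by (auto simp: zariski_closed_def)
  from bchoice[OF this] obtain P
    where "\<forall>C\<in>\<C>. {x. chart_map \<sigma> x \<in> C} = {x. \<forall>p\<in>P C. eval_poly x p = 0}" ..
  then have P: "\<And>C. C \<in> \<C> \<Longrightarrow> {x. chart_map \<sigma> x \<in> C} = {x. \<forall>p\<in>P C. eval_poly x p = 0}" by (rule bspec)
  have "{x. chart_map \<sigma> x \<in> sextuples \<inter> \<Inter>\<C>} = (\<Inter>C\<in>\<C>. {x. chart_map \<sigma> x \<in> C})"
    using chart_map_in_sextuples by auto
  also have "\<dots> = {x. \<forall>p\<in>(\<Union>C\<in>\<C>. P C). eval_poly x p = 0}"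
    using P by auto
  finally show "\<exists>P. {x. chart_map \<sigma> x \<in> sextuples \<inter> \<Inter>\<C>} = {x. \<forall>p\<in>P. eval_poly x p = 0}" by blast
qed auto

lemma zariski_closed_Un:
  assumes "zariski_closed C" "zariski_closed D"
  shows "zariski_closed (C \<union> D)"
  unfolding zariski_closed_def
proof (intro conjI allI)
  fix \<sigma>
  obtain P Q where P: "{x. chart_map \<sigma> x \<in> C} = {x. \<forall>p\<in>P. eval_poly x p = 0}"
    and Q: "{x. chart_map \<sigma> x \<in> D} = {x. \<forall>p\<in>Q. eval_poly x p = 0}"
    using assms unfolding zariski_closed_def by (elim conjE allE[where x=\<sigma>] exE) (rule that)
  have "{x. chart_map \<sigma> x \<in> C \<union> D} = {x. chart_map \<sigma> x \<in> C} \<union> {x. chart_map \<sigma> x \<in> D}" by auto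
  also have "\<dots> = {x. \<forall>r\<in>{p * q | p q. p \<in> P \<and> q \<in> Q}. eval_poly x r = 0}"
    unfolding P Q by (auto, metis eval_poly_simps(4) mult_eq_0_iff)
  finally show "\<exists>P. {x. chart_map \<sigma> x \<in> C \<union> D} = {x. \<forall>p\<in>P. eval_poly x p = 0}" by blast
next
  show "C \<union> D \<subseteq> sextuples" using assms by (auto simp: zariski_closed_def)
qed

lemma openin_zariski: "openin zariski U \<longleftrightarrow> U \<subseteq> sextuples \<and> zariski_closed (sextuples - U)"
proof -
  have "istopology (\<lambda>U. U \<subseteq> sextuples \<and> zariski_closed (sextuples - U))"
    unfolding istopology_def
  proof (intro conjI allI impI)
    fix S T assume "S \<subseteq> sextuples \<and> zariski_closed (sextuples - S)" "T \<subseteq> sextuples \<and> zariski_closed (sextuples - T)"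
    then show "zariski_closed (sextuples - S \<inter> T)"
      using zariski_closed_Un by (metis Diff_Int)
  next
    fix \<K> assume *: "\<forall>K\<in>\<K>. K \<subseteq> sextuples \<and> zariski_closed (sextuples - K)"
    have "sextuples - \<Union>\<K> = sextuples \<inter> \<Inter>((\<lambda>K. sextuples - K) ` \<K>)" by blast
    show "zariski_closed (sextuples - \<Union>\<K>)"
      unfolding \<open>sextuples - \<Union>\<K> = _\<close> using * by (intro zariski_closed_Int) blast
  qed auto
  then show ?thesis
    unfolding zariski_def by (simp add: topology_inverse')
qed

lemma topspace_zariski: "topspace zariski = sextuples"
proof -
  have "zariski_closed {}"
    by (auto simp: zariski_closed_def intro!: exI[of _ "{1}"])
  then have "openin zariski sextuples" by (simp add: openin_zariski)
  then show ?thesis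
    by (metis openin_zariski openin_subset openin_topspace subset_antisym)
qed

lemma closedin_zariski: "closedin zariski C \<longleftrightarrow> zariski_closed C"
  unfolding closedin_def topspace_zariski openin_zariski
  by (metis Diff_subset double_diff order_refl zariski_closed_def)

lemma multihomogenize_add:
  "multihomogenize d (p + q) = multihomogenize d p + multihomogenize d q"
proof -
  let ?M = "\<lambda>m. \<Sum>l\<in>UNIV. Poly_Mapping.single (HT l) (Poly_Mapping.lookup m l) +
                  Poly_Mapping.single (HS l) (d l - Poly_Mapping.lookup m l)"
  let ?S = "Poly_Mapping.keys p \<union> Poly_Mapping.keys q"
  have *: "multihomogenize d r = (\<Sum>m\<in>?S. Poly_Mapping.single (?M m) (Poly_Mapping.lookup r m))"
    if "Poly_Mapping.keys r \<subseteq> ?S" for r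
    unfolding multihomogenize_def using that
    by (intro sum.mono_neutral_left) (auto simp: in_keys_iff)
  show ?thesis
    using keys_add[of p q] by (simp add: * lookup_add single_add sum.distrib)
qed

lemma multihomogenize_uminus: "multihomogenize d (- p) = - multihomogenize d p"
  by (simp add: multihomogenize_def single_uminus sum_negf)

lemma multihomogenize_diff: "multihomogenize d (p - q) = multihomogenize d p - multihomogenize d q"
  using multihomogenize_add[of d p "- q"] by (simp add: multihomogenize_uminus)

lemma multihomogenize_single:
  "multihomogenize d (Poly_Mapping.single m k) = Poly_Mapping.single (\<Sum>l\<in>UNIV. Poly_Mapping.single (HT l) (Poly_Mapping.lookup m l) +
                  Poly_Mapping.single (HS l) (d l - Poly_Mapping.lookup m l)) k"
  by (cases "k = 0") (simp_all add: multihomogenize_def)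

lemma eval_multihomogenize_single:
  "eval_poly z (multihomogenize d (Poly_Mapping.single m k)) = k *
        (\<Prod>l\<in>UNIV. z (HT l) ^ Poly_Mapping.lookup m l * z (HS l) ^ (d l - Poly_Mapping.lookup m l))"
  by (cases "k = 0") (simp_all add: eval_multihomogenize)

lemma eval_pascal_forms:
  fixes z :: "hcoord \<Rightarrow> complex"
  defines "a \<equiv> z (HT LA)" and "b \<equiv> z (HT LB)" and "c \<equiv> z (HT LC)" 
    and "d \<equiv> z (HT LD)" and "e \<equiv> z (HT LE)" and "f \<equiv> z (HT LF)"
  defines "a' \<equiv> z (HS LA)" and "b' \<equiv> z (HS LB)" and "c' \<equiv> z (HS LC)" 
    and "d' \<equiv> z (HS LD)" and "e' \<equiv> z (HS LE)" and "f' \<equiv> z (HS LF)"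
  shows "eval_poly z (multihomogenize (\<lambda>_. 1) u0) =
      a*b*d*e*c'*f' - a*b*d*f*c'*e' - a*c*d*e*b'*f' + a*c*e*f*b'*d' + b*c*d*f*a'*e' - b*c*e*f*a'*d'"
    and "eval_poly z (multihomogenize (\<lambda>_. 1) u1) =
      - a*b*e*c'*d'*f' + a*b*f*c'*d'*e' + a*c*d*b'*e'*f' - a*c*f*b'*d'*e' + a*d*f*b'*c'*e' - a*e*f*b'*c'*d'
      - b*c*d*a'*e'*f' + b*c*e*a'*d'*f' - b*d*e*a'*c'*f' + b*e*f*a'*c'*d' + c*d*e*a'*b'*f' - c*d*f*a'*b'*e'"
    and "eval_poly z (multihomogenize (\<lambda>_. 1) u2) =
      - a*d*b'*c'*e'*f' + a*e*b'*c'*d'*f' + b*d*a'*c'*e'*f' - b*f*a'*c'*d'*e' - c*e*a'*b'*d'*f' + c*f*a'*b'*d'*e'"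
proof -
  have neg: "- Var v = (Poly_Mapping.single (Poly_Mapping.single v 1) (-1) :: letter cpoly)" for v
    by (simp add: Var_def single_uminus)
  note mh = multihomogenize_add multihomogenize_diff eval_poly_simps(3) eval_poly_minus
      mult_single Var_def neg[unfolded Var_def]
  note ev = eval_multihomogenize_single letter_UNIV lookup_add lookup_single
      a_def b_def c_def d_def e_def f_def a'_def b'_def c'_def d'_def e'_def f'_def
  show "eval_poly z (multihomogenize (\<lambda>_. 1) u0) =
      a*b*d*e*c'*f' - a*b*d*f*c'*e' - a*c*d*e*b'*f' + a*c*e*f*b'*d' + b*c*d*f*a'*e' - b*c*e*f*a'*d'"
    unfolding u0_def Let_def mh by (simp add: ev mult_ac)
  show "eval_poly z (multihomogenize (\<lambda>_. 1) u1) =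
      - a*b*e*c'*d'*f' + a*b*f*c'*d'*e' + a*c*d*b'*e'*f' - a*c*f*b'*d'*e' + a*d*f*b'*c'*e' - a*e*f*b'*c'*d'
      - b*c*d*a'*e'*f' + b*c*e*a'*d'*f' - b*d*e*a'*c'*f' + b*e*f*a'*c'*d' + c*d*e*a'*b'*f' - c*d*f*a'*b'*e'"
    unfolding u1_def Let_def mh by (simp add: ev mult_ac)
  show "eval_poly z (multihomogenize (\<lambda>_. 1) u2) =
      - a*d*b'*c'*e'*f' + a*e*b'*c'*d'*f' + b*d*a'*c'*e'*f' - b*f*a'*c'*d'*e' - c*e*a'*b'*d'*f' + c*f*a'*b'*d'*e'"
    unfolding u2_def Let_def mh by (simp add: ev mult_ac)
qed

lemma dehomogenize_multihomogenize_eval: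
  assumes "\<And>m l. m \<in> Poly_Mapping.keys p \<Longrightarrow> Poly_Mapping.lookup m l \<le> d l"
  shows "eval_poly x (dehomogenize (\<lambda>_. False) (multihomogenize d p)) = eval_poly x p"
  by (simp add: eval_dehomogenize eval_multihomogenize chart_coord_def eval_poly_alt[of x p])


section \<open>The forms represent the Pascal map\<close>

definition cross_c :: "complex ^ 3 \<Rightarrow> complex ^ 3 \<Rightarrow> complex ^ 3" where
  "cross_c v w = vector [v$2 * w$3 - v$3 * w$2, v$3 * w$1 - v$1 * w$3, v$1 * w$2 - v$2 * w$1]"

definition dot_c :: "complex ^ 3 \<Rightarrow> complex ^ 3 \<Rightarrow> complex" where
  "dot_c v w = (\<Sum>i\<in>UNIV. v $ i * w $ i)"

lemma dp_alt: "dot_c v w = v$1 * w$1 + v$2 * w$2 + v$3 * w$3"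
  by (simp add: dot_c_def sum_3)

lemma vec3_eq: "(v::complex^3) = w \<longleftrightarrow> v$1 = w$1 \<and> v$2 = w$2 \<and> v$3 = w$3"
  by (simp add: vec_eq_iff forall_3)

lemma incident_abs: "v \<noteq> 0 \<Longrightarrow> w \<noteq> 0 \<Longrightarrow> incident (abs_p2 v) (abs_p2 w) \<longleftrightarrow> dot_c v w = 0"
  unfolding dot_c_def by (subst incident.abs_eq) (auto intro!: exI[of _ "1::complex"])

lemma p2_cases: obtains v where "v \<noteq> 0" "p = abs_p2 v"
proof -
  have "\<exists>v. v \<noteq> 0 \<and> p = abs_p2 v" by (induct p rule: p2.abs_induct) auto
  with that show thesis by blast
qed

lemma abs_p2_eqI: "v \<noteq> 0 \<Longrightarrow> c \<noteq> 0 \<Longrightarrow> abs_p2 (c *s v) = abs_p2 v"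
proof -
  assume "v \<noteq> 0" "c \<noteq> 0"
  then have "abs_p2 v = abs_p2 (c *s v)"
    by (intro Quotient_rel_abs[OF Quotient_p2]) auto
  then show ?thesis by simp
qed

lemma cr_zero_imp:
  assumes "cross_c v w = 0" "v \<noteq> 0" "w \<noteq> 0"
  shows "abs_p2 v = abs_p2 w"
proof -
  have e: "v$2 * w$3 = v$3 * w$2" "v$3 * w$1 = v$1 * w$3" "v$1 * w$2 = v$2 * w$1"
    using assms(1) by (auto simp: cross_c_def vec3_eq)
  obtain i where i: "w $ i \<noteq> 0" using assms(3) by (auto simp: vec_eq_iff)
  have "v $ j * w $ i = v $ i * w $ j" for j
    using e exhaust_3[of i] exhaust_3[of j] by (auto simp: mult.commute)
  then have "v = (v $ i / w $ i) *s w"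
    using i by (simp add: vec_eq_iff field_simps)
  moreover from this have "v $ i / w $ i \<noteq> 0" using assms(2) by auto
  ultimately show ?thesis using abs_p2_eqI assms(3) by metis
qed

text \<open>Two vectors orthogonal to the same two independent vectors are proportional.\<close>
lemma orth_unique:
  assumes "cross_c p q \<noteq> 0" "u \<noteq> 0" "v \<noteq> 0" "dot_c u p = 0" "dot_c u q = 0" "dot_c v p = 0" "dot_c v q = 0"
  shows "abs_p2 u = abs_p2 v"
proof -
  have "cross_c u (cross_c p q) = 0" if "dot_c u p = 0" "dot_c u q = 0" for u
  proof -
    have "cross_c u (cross_c p q) $ i = dot_c u q * p $ i - dot_c u p * q $ i" for i
      using exhaust_3[of i] by (auto simp: cross_c_def dp_alt algebra_simps)
    with that show ?thesis by (simp add: vec_eq_iff)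
  qed
  then show ?thesis using assms cr_zero_imp by metis
qed

definition cpt :: "complex \<Rightarrow> complex \<Rightarrow> complex ^ 3" where
  "cpt s t = vector [s\<^sup>2, s * t, t\<^sup>2]"

definition chord :: "complex \<Rightarrow> complex \<Rightarrow> complex \<Rightarrow> complex \<Rightarrow> complex ^ 3" where
  "chord s t s' t' = vector [t * t', - (s * t' + t * s'), s * s']"

lemma dp_chord: "dot_c (chord s t s' t') (cpt s t) = 0" "dot_c (chord s t s' t') (cpt s' t') = 0"
  by (simp_all add: dp_alt chord_def cpt_def power2_eq_square algebra_simps)

lemma dp_chord_third: "dot_c (chord s t s' t') (cpt r q) = (s * q - t * r) * (s' * q - t' * r)"
  by (simp add: dp_alt chord_def cpt_def power2_eq_square algebra_simps)

lemma cr_cpt: "cross_c (cpt s t) (cpt s' t') = (s * t' - t * s') *s chord s t s' t'"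
  by (simp add: vec3_eq cross_c_def chord_def cpt_def power2_eq_square algebra_simps)

lemma cpt_nz: "s \<noteq> 0 \<or> t \<noteq> 0 \<Longrightarrow> cpt s t \<noteq> 0"
  by (auto simp: cpt_def vec3_eq)

lemma chord_nz: "s * t' - t * s' \<noteq> 0 \<Longrightarrow> chord s t s' t' \<noteq> 0"
  by (auto simp: chord_def vec3_eq)

lemma cr_chord_nz:
  assumes "a * c' - a' * c \<noteq> 0" "b * c' - b' * c \<noteq> 0" "a * b' - a' * b \<noteq> 0" "c * d' - c' * d \<noteq> 0"
  shows "cross_c (chord a a' b b') (chord c c' d d') \<noteq> 0"
proof
  assume "cross_c (chord a a' b b') (chord c c' d d') = 0"
  then have "abs_p2 (chord a a' b b') = abs_p2 (chord c c' d d')"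
    using cr_zero_imp chord_nz assms by metis
  moreover have "cpt c c' \<noteq> 0" using assms by (intro cpt_nz) auto
  ultimately have "dot_c (chord a a' b b') (cpt c c') = 0"
    using incident_abs chord_nz assms dp_chord(1) by metis
  then show False using assms by (simp add: dp_chord_third)
qed

lemma collinear3_chord:
  assumes "v \<noteq> 0" "s * t' - t * s' \<noteq> 0"
  shows "collinear3 (abs_p2 v) (abs_p2 (cpt s t)) (abs_p2 (cpt s' t')) \<longleftrightarrow> dot_c (chord s t s' t') v = 0"
proof -
  have nz: "cpt s t \<noteq> 0" "cpt s' t' \<noteq> 0" using assms by (auto intro!: cpt_nz)
  have cnz: "chord s t s' t' \<noteq> 0" using assms chord_nz by auto
  have crnz: "cross_c (cpt s t) (cpt s' t') \<noteq> 0"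
    using cnz assms by (auto simp: cr_cpt vec_eq_iff)
  show ?thesis
  proof
    assume "collinear3 (abs_p2 v) (abs_p2 (cpt s t)) (abs_p2 (cpt s' t'))"
    then obtain l where l: "incident l (abs_p2 v)" "incident l (abs_p2 (cpt s t))" "incident l (abs_p2 (cpt s' t'))"
      by (auto simp: collinear3_def)
    obtain w where w: "w \<noteq> 0" "l = abs_p2 w" by (rule p2_cases)
    have "l = abs_p2 (chord s t s' t')"
      using l nz w dp_chord unfolding w(2)
      by (intro orth_unique[OF crnz w(1) cnz]) (auto simp: incident_abs)
    with l(1) show "dot_c (chord s t s' t') v = 0" using incident_abs cnz assms by metis
  next
    assume "dot_c (chord s t s' t') v = 0"
    then show "collinear3 (abs_p2 v) (abs_p2 (cpt s t)) (abs_p2 (cpt s' t'))"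
      unfolding collinear3_def using nz cnz assms dp_chord incident_abs by metis
  qed
qed

text \<open>The condition that a line contains the intersection point of two chords.\<close>
lemma incident_cross:
  assumes "w \<noteq> 0" "a * c' - a' * c \<noteq> 0" "b * c' - b' * c \<noteq> 0" "a * b' - a' * b \<noteq> 0" "c * d' - c' * d \<noteq> 0"
  shows "(\<forall>X. collinear3 X (abs_p2 (cpt a a')) (abs_p2 (cpt b b')) \<and>
            collinear3 X (abs_p2 (cpt c c')) (abs_p2 (cpt d d')) \<longrightarrow> incident (abs_p2 w) X) \<longleftrightarrow>
     dot_c w (cross_c (chord a a' b b') (chord c c' d d')) = 0" (is "?L \<longleftrightarrow> ?R")
proof -
  let ?p = "cross_c (chord a a' b b') (chord c c' d d')"
  have nz: "?p \<noteq> 0" using assms by (intro cr_chord_nz) auto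
  have ab: "chord a a' b b' \<noteq> 0" and cd: "chord c c' d d' \<noteq> 0" using assms by (auto intro!: chord_nz)
  have o: "dot_c (chord a a' b b') ?p = 0" "dot_c (chord c c' d d') ?p = 0"
    by (simp_all add: dp_alt cross_c_def algebra_simps)
  have sym: "dot_c x y = dot_c y x" for x y by (simp add: dp_alt mult.commute)
  show ?thesis
  proof
    assume ?L
    then have "incident (abs_p2 w) (abs_p2 ?p)"
      using o assms nz by (auto simp: collinear3_chord)
    then show ?R using incident_abs assms nz by metis
  next
    assume ?R
    show ?L
    proof (intro allI impI)
      fix X assume X: "collinear3 X (abs_p2 (cpt a a')) (abs_p2 (cpt b b')) \<and>
            collinear3 X (abs_p2 (cpt c c')) (abs_p2 (cpt d d'))"
      obtain v where v: "v \<noteq> 0" "X = abs_p2 v" by (rule p2_cases)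
      have "dot_c (chord a a' b b') v = 0" "dot_c (chord c c' d d') v = 0"
        using X v assms by (auto simp: collinear3_chord)
      then have "abs_p2 v = abs_p2 ?p"
        using o by (intro orth_unique[of "chord a a' b b'" "chord c c' d d'"]) (use nz v in \<open>auto simp: sym[of v] sym[of ?p]\<close>)
      then show "incident (abs_p2 w) X" using \<open>?R\<close> v incident_abs assms(1) nz by metis
    qed
  qed
qed

definition pascal_vec :: "(hcoord \<Rightarrow> complex) \<Rightarrow> complex ^ 3" where
  "pascal_vec z = vector [eval_poly z (multihomogenize (\<lambda>_. 1) u0),
     eval_poly z (multihomogenize (\<lambda>_. 1) u1), eval_poly z (multihomogenize (\<lambda>_. 1) u2)]"

lemma pascal_vec_orth:
  fixes z
  defines "ch \<equiv> \<lambda>l m. chord (z (HS l)) (z (HT l)) (z (HS m)) (z (HT m))"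
  shows "dot_c (pascal_vec z) (cross_c (ch LA LE) (ch LB LF)) = 0"
    "dot_c (pascal_vec z) (cross_c (ch LA LD) (ch LC LF)) = 0"
    "dot_c (pascal_vec z) (cross_c (ch LB LD) (ch LC LE)) = 0"
  unfolding dp_alt pascal_vec_def vector_3 eval_pascal_forms cross_c_def ch_def chord_def
  by algebra+

lemma pascal_vec_cross:
  fixes z
  defines "ch \<equiv> \<lambda>l m. chord (z (HS l)) (z (HT l)) (z (HS m)) (z (HT m))"
  defines "br \<equiv> \<lambda>l m. z (HS l) * z (HT m) - z (HT l) * z (HS m)"
  shows "cross_c (ch LA LD) (pascal_vec z) = (- (br LA LB * br LD LE)) *s cross_c (ch LA LD) (ch LC LF)"
  unfolding vec3_eq pascal_vec_def vector_3 eval_pascal_forms cross_c_def ch_def chord_def br_def vector_smult_component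
  apply (intro conjI)
  apply algebra+
  done


lemma pascal_cross:
  fixes z
  defines "ch \<equiv> \<lambda>l m. chord (z (HS l)) (z (HT l)) (z (HS m)) (z (HT m))"
  defines "br \<equiv> \<lambda>l m. z (HS l) * z (HT m) - z (HT l) * z (HS m)"
  shows "cross_c (cross_c (ch LA LE) (ch LB LF)) (cross_c (ch LA LD) (ch LC LF)) = br LA LF *s pascal_vec z"
  unfolding vec3_eq pascal_vec_def vector_3 eval_pascal_forms cross_c_def ch_def chord_def br_def vector_smult_component
  apply (intro conjI)
  apply algebra+
  done

lemma pascal_map_cpt:
  fixes z
  defines "h \<equiv> \<lambda>l. abs_p2 (cpt (z (HS l)) (z (HT l)))"
  assumes nz: "\<And>l m. l \<noteq> m \<Longrightarrow> z (HS l) * z (HT m) - z (HT l) * z (HS m) \<noteq> 0"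
  shows "pascal_vec z \<noteq> 0" "pascal_map h = abs_p2 (pascal_vec z)"
proof -
  define ch where "ch = (\<lambda>l m. chord (z (HS l)) (z (HT l)) (z (HS m)) (z (HT m)))"
  let ?P = "cross_c (ch LA LE) (ch LB LF)" and ?Q = "cross_c (ch LA LD) (ch LC LF)" and ?R = "cross_c (ch LB LD) (ch LC LE)"
  have Q: "?Q \<noteq> 0" unfolding ch_def by (rule cr_chord_nz[OF nz nz nz nz]) simp_all
  show V: "pascal_vec z \<noteq> 0"
  proof
    assume 0: "pascal_vec z = 0"
    have "cross_c (ch LA LD) (pascal_vec z) = 0" unfolding 0 by (simp add: cross_c_def vec3_eq)
    with pascal_vec_cross[of z] Q nz[of LA LB] nz[of LD LE] show False
      by (simp add: ch_def)
  qed
  have PQ: "cross_c ?P ?Q \<noteq> 0"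
    using pascal_cross[of z] V nz[of LA LF] by (simp add: ch_def)
  have inc: "(\<forall>X. collinear3 X (h l) (h m) \<and> collinear3 X (h l') (h m') \<longrightarrow> incident (abs_p2 w) X) \<longleftrightarrow>
     dot_c w (cross_c (ch l m) (ch l' m')) = 0" if "w \<noteq> 0" "l \<noteq> l'" "m \<noteq> l'" "l \<noteq> m" "l' \<noteq> m'" for w l m l' m'
    unfolding h_def ch_def by (rule incident_cross[OF that(1) nz nz nz nz]) (use that in simp_all)
  let ?pr = "\<lambda>u.
     (\<forall>X. collinear3 X (h LA) (h LE) \<and> collinear3 X (h LB) (h LF) \<longrightarrow> incident u X) \<and>
     (\<forall>X. collinear3 X (h LA) (h LD) \<and> collinear3 X (h LC) (h LF) \<longrightarrow> incident u X) \<and>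
     (\<forall>X. collinear3 X (h LB) (h LD) \<and> collinear3 X (h LC) (h LE) \<longrightarrow> incident u X)"
  have pr: "?pr (abs_p2 w) \<longleftrightarrow> dot_c w ?P = 0 \<and> dot_c w ?Q = 0 \<and> dot_c w ?R = 0" if "w \<noteq> 0" for w
    using that by (subst inc, simp_all)+
  have ex: "?pr (abs_p2 (pascal_vec z))"
    unfolding pr[OF V] using pascal_vec_orth[of z] by (simp add: ch_def)
  show "pascal_map h = abs_p2 (pascal_vec z)"
    unfolding pascal_map_def
  proof (rule the_equality)
    show "?pr (abs_p2 (pascal_vec z))" by (rule ex)
  next
    fix u assume u: "?pr u"
    obtain w where w: "w \<noteq> 0" "u = abs_p2 w" by (rule p2_cases)
    have "dot_c w ?P = 0 \<and> dot_c w ?Q = 0" using u pr[OF w(1)] unfolding w(2) by blast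
    moreover have "dot_c (pascal_vec z) ?P = 0 \<and> dot_c (pascal_vec z) ?Q = 0" using ex pr[OF V] by blast
    ultimately show "u = abs_p2 (pascal_vec z)"
      unfolding w(2) using orth_unique[OF PQ w(1) V] by blast
  qed
qed

text \<open>On every chart the three forms give the Pascal line of six pairwise distinct points.\<close>
theorem pascal_forms_represent_pascal_map:
  fixes x :: "letter \<Rightarrow> complex"
  assumes "inj (chart_map \<sigma> x)"
  defines "v \<equiv> (vector [eval_poly x (dehomogenize \<sigma> (multihomogenize (\<lambda>_. 1) u0)),
     eval_poly x (dehomogenize \<sigma> (multihomogenize (\<lambda>_. 1) u1)),
     eval_poly x (dehomogenize \<sigma> (multihomogenize (\<lambda>_. 1) u2))] :: complex ^ 3)"
  shows "v \<noteq> 0" "pascal_map (chart_map \<sigma> x) = abs_p2 v"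
proof -
  define z where "z = (\<lambda>v. eval_poly x (chart_coord \<sigma> v))"
  have v: "v = pascal_vec z" by (simp add: v_def z_def pascal_vec_def eval_dehomogenize)
  have h: "chart_map \<sigma> x = (\<lambda>l. abs_p2 (cpt (z (HS l)) (z (HT l))))"
    by (simp add: fun_eq_iff chart_map_def conic_point_def z_def chart_coord_def cpt_def)
  have "z (HS l) * z (HT m) - z (HT l) * z (HS m) \<noteq> 0" if "l \<noteq> m" for l m
  proof
    assume "z (HS l) * z (HT m) - z (HT l) * z (HS m) = 0"
    then have "cross_c (cpt (z (HS l)) (z (HT l))) (cpt (z (HS m)) (z (HT m))) = 0"
      by (simp add: cr_cpt)
    moreover have "cpt (z (HS l)) (z (HT l)) \<noteq> 0" for l
      by (rule cpt_nz) (auto simp: z_def chart_coord_def)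
    ultimately have "chart_map \<sigma> x l = chart_map \<sigma> x m" unfolding h by (intro cr_zero_imp)
    with assms that show False by (auto dest: injD)
  qed
  from pascal_map_cpt[OF this] show "v \<noteq> 0" "pascal_map (chart_map \<sigma> x) = abs_p2 v"
    unfolding v h by auto
qed


section \<open>The families of ideals are closed subschemes\<close>

lemma digits_unique:
  fixes a b :: "nat \<Rightarrow> nat"
  assumes "\<And>k. a k < B" "\<And>k. b k < B" "(\<Sum>k<n. a k * B ^ k) = (\<Sum>k<n. b k * B ^ k)" "k < n"
  shows "a k = b k"
  using assms
proof (induction n arbitrary: a b k)
  case (Suc n)
  have e: "(\<Sum>k<Suc n. f k * B ^ k) = f 0 + B * (\<Sum>k<n. f (Suc k) * B ^ k)" for f :: "nat \<Rightarrow> nat"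
    by (simp add: sum.lessThan_Suc_shift sum_distrib_left mult_ac del: sum.lessThan_Suc)
  have eq: "a 0 + B * (\<Sum>k<n. a (Suc k) * B ^ k) = b 0 + B * (\<Sum>k<n. b (Suc k) * B ^ k)"
    using Suc.prems(3) unfolding e .
  have 0: "a 0 = b 0"
    using arg_cong[OF eq, of "\<lambda>t. t mod B"] Suc.prems(1)[of 0] Suc.prems(2)[of 0] by simp
  have "B > 0" using Suc.prems(1)[of 0] by simp
  with eq 0 have "(\<Sum>k<n. a (Suc k) * B ^ k) = (\<Sum>k<n. b (Suc k) * B ^ k)" by simp
  then show ?case
    using Suc.IH[of "\<lambda>k. a (Suc k)" "\<lambda>k. b (Suc k)" "k - 1"] Suc.prems 0 by (cases k) auto
qed auto

lemma cpoly_eq_0: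
  fixes p :: "('v::finite) cpoly"
  assumes "\<And>x. (\<And>v. x v \<noteq> 0) \<Longrightarrow> eval_poly x p = 0"
  shows "p = 0"
proof -
  obtain e :: "'v \<Rightarrow> nat" and n where e: "inj e" "range e = {i. i < n}"
    using finite_imp_inj_to_nat_seg[of "UNIV :: 'v set"] by auto
  define B where "B = Suc (\<Sum>m\<in>Poly_Mapping.keys p. \<Sum>v\<in>UNIV. Poly_Mapping.lookup m v)"
  have B: "Poly_Mapping.lookup m v < B" if "m \<in> Poly_Mapping.keys p" for m v
  proof -
    have "Poly_Mapping.lookup m v \<le> (\<Sum>v\<in>UNIV. Poly_Mapping.lookup m v)"
      by (rule member_le_sum) auto
    also have "\<dots> \<le> (\<Sum>m\<in>Poly_Mapping.keys p. \<Sum>v\<in>UNIV. Poly_Mapping.lookup m v)"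
      by (rule member_le_sum) (use that in auto)
    finally show ?thesis by (simp add: B_def)
  qed
  define N where "N m = (\<Sum>v\<in>UNIV. Poly_Mapping.lookup m v * B ^ e v)" for m
  have N: "N m = (\<Sum>k<n. Poly_Mapping.lookup m (inv e k) * B ^ k)" for m
    unfolding N_def
    by (rule sum.reindex_bij_witness[of _ "inv e" e]) (use e in \<open>auto simp: f_inv_into_f\<close>)
  have inj: "inj_on N (Poly_Mapping.keys p)"
  proof (rule inj_onI)
    fix m m' assume mm: "m \<in> Poly_Mapping.keys p" "m' \<in> Poly_Mapping.keys p" "N m = N m'"
    have "Poly_Mapping.lookup m (inv e k) = Poly_Mapping.lookup m' (inv e k)" if "k < n" for k
      using digits_unique[of "\<lambda>k. Poly_Mapping.lookup m (inv e k)" B "\<lambda>k. Poly_Mapping.lookup m' (inv e k)" n k] B mm that unfolding N by blast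
    moreover have "inv e (e v) = v \<and> e v < n" for v using e by auto
    ultimately have "Poly_Mapping.lookup m v = Poly_Mapping.lookup m' v" for v by metis
    then show "m = m'" by (intro poly_mapping_eqI)
  qed
  define q where "q = (\<Sum>m\<in>Poly_Mapping.keys p. monom (Poly_Mapping.lookup p m) (N m))"
  have "poly q t = 0" if "t \<noteq> 0" for t
  proof -
    have "poly q t = eval_poly (\<lambda>v. t ^ (B ^ e v)) p"
      by (simp add: q_def poly_sum poly_monom eval_poly_alt N_def power_sum power_mult[symmetric] mult.commute)
    with that show ?thesis by (simp add: assms)
  qed
  then have "- {0} \<subseteq> {t. poly q t = 0}" by auto
  moreover have "infinite (- {0::complex})"
    using infinite_UNIV_char_0[where 'a=complex] by (simp add: Compl_eq_Diff_UNIV)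
  ultimately have "q = 0" using poly_roots_finite finite_subset by blast
  have "Poly_Mapping.lookup p m = 0" for m
  proof (cases "m \<in> Poly_Mapping.keys p")
    case True
    have "coeff q (N m) = (\<Sum>m'\<in>Poly_Mapping.keys p. if m' = m then Poly_Mapping.lookup p m' else 0)"
      unfolding q_def coeff_sum
      by (rule sum.cong) (use inj True in \<open>auto dest: inj_onD\<close>)
    with \<open>q = 0\<close> True show ?thesis by simp
  qed (simp add: in_keys_iff)
  then show ?thesis by (intro poly_mapping_eqI) simp
qed

lemma cpoly_eqI:
  fixes p q :: "('v::finite) cpoly"
  assumes "\<And>x. (\<And>v. x v \<noteq> 0) \<Longrightarrow> eval_poly x p = eval_poly x q"
  shows "p = q"
  using cpoly_eq_0[of "p - q"] assms by simp

lemma dehomogenize_multihomogenize: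
  assumes "\<And>m l. m \<in> Poly_Mapping.keys p \<Longrightarrow> Poly_Mapping.lookup m l \<le> d l"
  shows "dehomogenize (\<lambda>_. False) (multihomogenize d p) = p"
  by (rule cpoly_eqI) (rule dehomogenize_multihomogenize_eval[OF assms])

lemma dehomogenize_pascal_forms:
  "dehomogenize (\<lambda>_. False) ` pascal_forms = {u0, u1, u2}"
proof -
  have "dehomogenize (\<lambda>_. False) (multihomogenize (\<lambda>_. 1) u0) = u0"
    "dehomogenize (\<lambda>_. False) (multihomogenize (\<lambda>_. 1) u1) = u1"
    "dehomogenize (\<lambda>_. False) (multihomogenize (\<lambda>_. 1) u2) = u2"
    by (rule cpoly_eqI, simp only: eval_dehomogenize eval_pascal_forms,
        simp add: chart_coord_def u0_def u1_def u2_def Let_def)+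
  then show ?thesis by (simp add: pascal_forms_def)
qed

interpretation cpoly_ideal: module "(*) :: letter cpoly \<Rightarrow> _"
  by unfold_locales (simp_all add: algebra_simps)

text \<open>On the affine chart the indeterminacy scheme is defined by the ideal \<open>(u\<^sub>0, u\<^sub>1, u\<^sub>2)\<close>.\<close>
lemma indeterminacy_scheme_affine:
  "indeterminacy_scheme (\<lambda>_. False) = module.span (*) {u0, u1, u2}"
  by (simp add: indeterminacy_scheme_def common_zero_scheme_def dehomogenize_pascal_forms)

lemma invert_poly:
  fixes p :: "letter cpoly"
  shows "\<exists>K q. \<forall>y. (\<forall>l\<in>D. y l \<noteq> 0) \<longrightarrow>
    eval_poly y q = (\<Prod>l\<in>D. y l) ^ K * eval_poly (\<lambda>l. if l \<in> D then inverse (y l) else y l) p"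
proof -
  define K where "K = (\<Sum>m\<in>Poly_Mapping.keys p. \<Sum>v\<in>UNIV. Poly_Mapping.lookup m v)"
  have K: "Poly_Mapping.lookup m v \<le> K" if "m \<in> Poly_Mapping.keys p" for m v
  proof -
    have "Poly_Mapping.lookup m v \<le> (\<Sum>v\<in>UNIV. Poly_Mapping.lookup m v)"
      by (rule member_le_sum) auto
    also have "\<dots> \<le> K"
      unfolding K_def by (rule member_le_sum) (use that in auto)
    finally show ?thesis .
  qed
  define q :: "letter cpoly" where "q = (\<Sum>m\<in>Poly_Mapping.keys p. Poly_Mapping.single 0 (Poly_Mapping.lookup p m) *
     (\<Prod>l\<in>UNIV. Var l ^ (if l \<in> D then K - Poly_Mapping.lookup m l else Poly_Mapping.lookup m l)))"
  have "eval_poly y q = (\<Prod>l\<in>D. y l) ^ K * eval_poly (\<lambda>l. if l \<in> D then inverse (y l) else y l) p"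
    if y: "\<forall>l\<in>D. y l \<noteq> 0" for y
  proof -
    have "(\<Prod>l\<in>UNIV. y l ^ (if l \<in> D then K - Poly_Mapping.lookup m l else Poly_Mapping.lookup m l)) =
       (\<Prod>l\<in>D. y l) ^ K * (\<Prod>l\<in>UNIV. (if l \<in> D then inverse (y l) else y l) ^ Poly_Mapping.lookup m l)"
      if m: "m \<in> Poly_Mapping.keys p" for m
    proof -
      have "(\<Prod>l\<in>D. y l) ^ K = (\<Prod>l\<in>UNIV. if l \<in> D then y l ^ K else 1)"
        by (simp add: prod.If_cases prod_power_distrib)
      then have "(\<Prod>l\<in>D. y l) ^ K * (\<Prod>l\<in>UNIV. (if l \<in> D then inverse (y l) else y l) ^ Poly_Mapping.lookup m l) =
         (\<Prod>l\<in>UNIV. (if l \<in> D then y l ^ K else 1) * (if l \<in> D then inverse (y l) else y l) ^ Poly_Mapping.lookup m l)"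
        by (simp only: prod.distrib)
      also have "\<dots> = (\<Prod>l\<in>UNIV. y l ^ (if l \<in> D then K - Poly_Mapping.lookup m l else Poly_Mapping.lookup m l))"
        by (rule prod.cong[OF refl]) (use y K[OF m] in \<open>auto simp: power_diff field_simps\<close>)
      finally show ?thesis by simp
    qed
    then show ?thesis
      unfolding q_def by (simp add: eval_poly_alt[of _ p] sum_distrib_left mult_ac)
  qed
  then show ?thesis by blast
qed

lemma pascal_forms_transition:
  fixes \<sigma> \<tau> :: chart and y :: "letter \<Rightarrow> complex"
  defines "D \<equiv> {l. \<sigma> l \<noteq> \<tau> l}"
  assumes "\<forall>l\<in>D. y l \<noteq> 0" "F \<in> pascal_forms"
  shows "eval_poly y (dehomogenize \<tau> F) =
    (\<Prod>l\<in>D. y l) * eval_poly (\<lambda>l. if l \<in> D then inverse (y l) else y l) (dehomogenize \<sigma> F)"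
proof -
  let ?x = "\<lambda>l. if l \<in> D then inverse (y l) else y l"
  define z where "z = (\<lambda>v. eval_poly y (chart_coord \<tau> v))"
  define w where "w = (\<lambda>v. eval_poly ?x (chart_coord \<sigma> v))"
  define r where "r = (\<lambda>l. if l \<in> D then y l else 1)"
  have z: "z (HS l) = r l * w (HS l)" "z (HT l) = r l * w (HT l)" for l
    using assms(2) by (auto simp: z_def w_def r_def chart_coord_def D_def)
  have "(\<Prod>l\<in>D. y l) = (\<Prod>l\<in>UNIV. r l)"
    by (simp add: r_def prod.If_cases)
  also have "\<dots> = r LA * r LB * r LC * r LD * r LE * r LF"
    by (simp add: letter_UNIV mult_ac)
  finally have P: "(\<Prod>l\<in>D. y l) = r LA * r LB * r LC * r LD * r LE * r LF" .
  have "eval_poly z F = (\<Prod>l\<in>D. y l) * eval_poly w F"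
    using assms(3) unfolding pascal_forms_def P
    apply (simp only: image_insert image_empty insert_iff empty_iff)
    apply (elim disjE; simp only: eval_pascal_forms z)
       apply (simp_all add: algebra_simps)
    done
  then show ?thesis by (simp add: eval_dehomogenize z_def w_def)
qed

lemma closed_subscheme_indeterminacy_scheme: "closed_subscheme indeterminacy_scheme"
  unfolding closed_subscheme_def Let_def
proof (intro conjI allI impI)
  show "cpoly_ideal.subspace (indeterminacy_scheme \<sigma>)" for \<sigma>
    by (simp add: indeterminacy_scheme_def common_zero_scheme_def cpoly_ideal.subspace_span)
next
  fix \<sigma> \<tau> :: chart and f g N
  define D where "D = {l. \<sigma> l \<noteq> \<tau> l}"
  let ?J = "indeterminacy_scheme \<tau>" and ?x = "\<lambda>y l. if l \<in> D then inverse (y l) else y l :: complex"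
  let ?Y = "\<Prod>l\<in>D. Var l :: letter cpoly"
  have J: "cpoly_ideal.subspace ?J"
    by (simp add: indeterminacy_scheme_def common_zero_scheme_def cpoly_ideal.subspace_span)
  note Jadd = cpoly_ideal.subspace_add[OF J] and Jmult = cpoly_ideal.subspace_scale[OF J]
  assume f: "f \<in> indeterminacy_scheme \<sigma>"
    and g: "\<forall>y. (\<forall>l\<in>{l. \<sigma> l \<noteq> \<tau> l}. y l \<noteq> 0) \<longrightarrow>
           eval_poly y g = (\<Prod>l\<in>{l. \<sigma> l \<noteq> \<tau> l}. y l) ^ N *
             eval_poly (\<lambda>l. if l \<in> {l. \<sigma> l \<noteq> \<tau> l} then inverse (y l) else y l) f"
  define good where "good p \<longleftrightarrow> (\<exists>K. \<exists>q\<in>?J. \<forall>y. (\<forall>l\<in>D. y l \<noteq> 0) \<longrightarrow>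
       eval_poly y q = (\<Prod>l\<in>D. y l) ^ K * eval_poly (?x y) p)" for p
  from f have "f \<in> cpoly_ideal.span (dehomogenize \<sigma> ` pascal_forms)"
    by (simp add: indeterminacy_scheme_def common_zero_scheme_def)
  then have "good f"
  proof (induction rule: cpoly_ideal.span_induct_alt)
    case base
    show ?case unfolding good_def using cpoly_ideal.subspace_0[OF J] by (intro exI[of _ 0] bexI[of _ 0]) auto
  next
    case (step c p q)
    from step(1) obtain F where F: "F \<in> pascal_forms" "p = dehomogenize \<sigma> F" by auto
    have FJ: "dehomogenize \<tau> F \<in> ?J"
      using F by (auto simp: indeterminacy_scheme_def common_zero_scheme_def intro!: cpoly_ideal.span_base)
    obtain K1 c' where c': "\<And>y. (\<forall>l\<in>D. y l \<noteq> 0) \<Longrightarrow> eval_poly y c' = (\<Prod>l\<in>D. y l) ^ K1 * eval_poly (?x y) c"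
      using invert_poly[of D c] by blast
    obtain K2 q' where q': "q' \<in> ?J" "\<And>y. (\<forall>l\<in>D. y l \<noteq> 0) \<Longrightarrow> eval_poly y q' = (\<Prod>l\<in>D. y l) ^ K2 * eval_poly (?x y) q"
      using step(2) unfolding good_def by blast
    have "?Y ^ K2 * (c' * dehomogenize \<tau> F) + ?Y ^ Suc K1 * q' \<in> ?J"
      by (intro Jadd Jmult FJ q')
    moreover have "eval_poly y (?Y ^ K2 * (c' * dehomogenize \<tau> F) + ?Y ^ Suc K1 * q') =
        (\<Prod>l\<in>D. y l) ^ (K2 + Suc K1) * eval_poly (?x y) (c * p + q)" if y: "\<forall>l\<in>D. y l \<noteq> 0" for y
    proof -
      have e: "eval_poly y (dehomogenize \<tau> F) = (\<Prod>l\<in>D. y l) * eval_poly (?x y) p"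
        using pascal_forms_transition[OF y[unfolded D_def] F(1), folded D_def] unfolding F(2) .
      show ?thesis
        unfolding eval_poly_simps eval_poly_power eval_poly_prod e c'[OF y] q'(2)[OF y] power_add power_Suc
        by (simp only: distrib_left mult_ac)
    qed
    ultimately show ?case unfolding good_def by blast
  qed
  then obtain K q where q: "q \<in> ?J" "\<And>y. (\<forall>l\<in>D. y l \<noteq> 0) \<Longrightarrow> eval_poly y q = (\<Prod>l\<in>D. y l) ^ K * eval_poly (?x y) f"
    unfolding good_def by blast
  have "?Y ^ K * g = ?Y ^ N * q"
  proof (rule cpoly_eqI)
    fix y :: "letter \<Rightarrow> complex" assume "\<And>v. y v \<noteq> 0"
    then have y: "\<forall>l\<in>D. y l \<noteq> 0" by simp
    show "eval_poly y (?Y ^ K * g) = eval_poly y (?Y ^ N * q)"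
      using q(2)[OF y] g[rule_format, of y, folded D_def] y by (simp add: mult_ac)
  qed
  then have "?Y ^ K * g \<in> ?J" using Jmult[OF q(1)] by simp
  then show "\<exists>M. (\<Prod>l\<in>{l. \<sigma> l \<noteq> \<tau> l}. Var l) ^ M * g \<in> ?J"
    unfolding D_def by blast
qed

lemma conic_point_inverse: "a \<noteq> 0 \<Longrightarrow> conic_point b (inverse a) = conic_point (\<not> b) a"
proof -
  assume a: "a \<noteq> 0"
  have *: "conic_point b a = abs_p2 (cpt (if b then a else 1) (if b then 1 else a))" for b a
    by (simp add: conic_point_def cpt_def)
  show ?thesis unfolding *
    by (rule cr_zero_imp) (use a in \<open>auto simp: cr_cpt intro!: cpt_nz\<close>)
qed

lemma closed_subscheme_reduced_structure: "closed_subscheme (reduced_structure Z)"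
  unfolding closed_subscheme_def Let_def
proof (intro conjI allI impI)
  show "cpoly_ideal.subspace (reduced_structure Z \<sigma>)" for \<sigma>
    by (rule cpoly_ideal.subspaceI) (auto simp: reduced_structure_def)
next
  fix \<sigma> \<tau> :: chart and f g N
  define D where "D = {l. \<sigma> l \<noteq> \<tau> l}"
  assume f: "f \<in> reduced_structure Z \<sigma>"
    and g: "\<forall>y. (\<forall>l\<in>{l. \<sigma> l \<noteq> \<tau> l}. y l \<noteq> 0) \<longrightarrow>
           eval_poly y g = (\<Prod>l\<in>{l. \<sigma> l \<noteq> \<tau> l}. y l) ^ N *
             eval_poly (\<lambda>l. if l \<in> {l. \<sigma> l \<noteq> \<tau> l} then inverse (y l) else y l) f"
  have "(\<Prod>l\<in>D. y l) * eval_poly y g = 0" if y: "chart_map \<tau> y \<in> Z" for y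
  proof (cases "\<forall>l\<in>D. y l \<noteq> 0")
    case True
    let ?x = "\<lambda>l. if l \<in> D then inverse (y l) else y l"
    have "chart_map \<sigma> ?x = chart_map \<tau> y"
    proof
      fix l show "chart_map \<sigma> ?x l = chart_map \<tau> y l"
        using True conic_point_inverse[of "y l" "\<sigma> l"] by (cases "l \<in> D") (auto simp: chart_map_def D_def)
    qed
    with y f have "eval_poly ?x f = 0" by (simp add: reduced_structure_def)
    with g[rule_format, of y, folded D_def] True show ?thesis by simp
  next
    case False
    then have "(\<Prod>l\<in>D. y l) = 0" by (simp add: prod_zero_iff)
    then show ?thesis by simp
  qed
  then have "(\<Prod>l\<in>D. Var l) ^ 1 * g \<in> reduced_structure Z \<tau>"
    by (simp add: reduced_structure_def)
  then show "\<exists>M. (\<Prod>l\<in>{l. \<sigma> l \<noteq> \<tau> l}. Var l) ^ M * g \<in> reduced_structure Z \<tau>"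
    unfolding D_def by blast
qed

lemma closed_subscheme_union:
  assumes "finite \<Z>" "\<And>I. I \<in> \<Z> \<Longrightarrow> closed_subscheme I"
  shows "closed_subscheme (scheme_union \<Z>)"
proof -
  have sub: "cpoly_ideal.subspace (I \<sigma>)" if "I \<in> \<Z>" for I \<sigma>
    using assms(2)[OF that] by (simp add: closed_subscheme_def)
  show ?thesis
  unfolding closed_subscheme_def Let_def
proof (intro conjI allI impI)
  show "cpoly_ideal.subspace (scheme_union \<Z> \<sigma>)" for \<sigma>
    unfolding scheme_union_def by (rule cpoly_ideal.subspace_Inter) (auto intro: sub)
next
  fix \<sigma> \<tau> :: chart and f g N
  let ?D = "{l. \<sigma> l \<noteq> \<tau> l}"
  assume f: "f \<in> scheme_union \<Z> \<sigma>"
    and g: "\<forall>y. (\<forall>l\<in>?D. y l \<noteq> 0) \<longrightarrow>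
           eval_poly y g = (\<Prod>l\<in>?D. y l) ^ N *
             eval_poly (\<lambda>l. if l \<in> ?D then inverse (y l) else y l) f"
  let ?Y = "\<Prod>l\<in>?D. Var l :: letter cpoly"
  have "\<exists>M. ?Y ^ M * g \<in> I \<tau>" if "I \<in> \<Z>" for I
  proof -
    have "f \<in> I \<sigma>" using f that by (simp add: scheme_union_def)
    with g show ?thesis
      using assms(2)[OF that, unfolded closed_subscheme_def Let_def, THEN conjunct2, rule_format, of f \<sigma> \<tau> g N]
      by blast
  qed
  then have "\<forall>I\<in>\<Z>. \<exists>M. ?Y ^ M * g \<in> I \<tau>" by simp
  from bchoice[OF this] obtain M where "\<forall>I\<in>\<Z>. ?Y ^ M I * g \<in> I \<tau>" ..
  then have M: "\<And>I. I \<in> \<Z> \<Longrightarrow> ?Y ^ M I * g \<in> I \<tau>" by (rule bspec)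
  have "?Y ^ (\<Sum>I\<in>\<Z>. M I) * g \<in> I \<tau>" if I: "I \<in> \<Z>" for I
  proof -
    have "(\<Sum>I\<in>\<Z>. M I) = (\<Sum>I\<in>\<Z> - {I}. M I) + M I"
      using assms(1) I by (simp add: sum.remove)
    then have "?Y ^ (\<Sum>I\<in>\<Z>. M I) * g = ?Y ^ (\<Sum>I\<in>\<Z> - {I}. M I) * (?Y ^ M I * g)"
      by (simp only: power_add mult.assoc)
    with cpoly_ideal.subspace_scale[OF sub[OF I] M[OF I]] show ?thesis by simp
  qed
  then show "\<exists>M. ?Y ^ M * g \<in> scheme_union \<Z> \<tau>"
    unfolding scheme_union_def by blast
qed
qed

end

theory Submission
  imports Defs
begin

text \<open>Write \<open>x = b - c\<close>, \<open>y = c - a\<close>, \<open>z = a - b\<close> and, for the opposite letters, \<open>x' = e - d\<close>,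
  \<open>y' = d - f\<close>, \<open>z' = f - e\<close>. On the affine chart the six polydiagonals are the linear subspaces
  given by \<open>(x, y)\<close>, \<open>(x', y')\<close>, \<open>(z, z')\<close>, \<open>(x, x')\<close>, \<open>(y, y')\<close> and \<open>(a - f, b - e, c - d)\<close>.

  The intersection of their ideals can be computed by hand. The first two ideals involve disjoint
  sets of variables, so they intersect in their product, generated by \<open>x x'\<close>, \<open>x y'\<close>, \<open>y x'\<close>,
  \<open>y y'\<close>. Vanishing on the fourth and fifth subspace allows one to absorb the multiples of \<open>x x'\<close>
  and \<open>y y'\<close>, leaving \<open>\<beta> x y' + \<gamma> y x'\<close>; vanishing on the third forces \<open>\<beta> + \<gamma>\<close> into \<open>(z, z')\<close>;
  vanishing on the sixth then leaves combinations of \<open>x y' - y x' = u\<^sub>2\<close>, of \<open>y x' (z - z')\<close> and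
  of \<open>y x' z'\<close> times \<open>a - f\<close>, \<open>b - e\<close> or \<open>c - d\<close>. All of these lie in \<open>(u\<^sub>0, u\<^sub>1, u\<^sub>2)\<close>. The
  reason is that \<open>U(v) = u\<^sub>0 + u\<^sub>1 v + u\<^sub>2 v\<^sup>2\<close> expresses the incidence of the Pascal line with
  the point \<open>\<tau>(v)\<close>, and its value at each of the six points is a product of four differences. This
  is \<open>vanishing_on_diagonals_imp_pascal_ideal\<close>.

  On the other charts the polydiagonals are in general not linear, but the group of the conic
  helps: for every complex \<open>t\<close> the coordinate \<open>v / (1 - t v)\<close> identifies the sextuples avoiding
  the point of parameter \<open>1 / t\<close> (the point \<open>\<tau>(\<infinity>)\<close> for \<open>t = 0\<close>) with an affine space, where the
  computation above applies. If \<open>f\<close> vanishes on all polydiagonals, this puts \<open>G\<^sub>t\<^sup>N f\<close> into the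
  ideal of base points of the chart, where \<open>G\<^sub>t\<close> is the product over the letters of the equations
  \<open>away_from\<close> of that point (\<open>vanishing_on_diagonals_locally\<close>). For a fixed letter the equations
  of two distinct points are comaximal, and an induction over the letters shows that an ideal
  containing powers of infinitely many \<open>G\<^sub>t\<close> contains 1 (\<open>away_from_ideal_unit\<close>).

  Hence the scheme of base points is the reduced structure on the union of the six polydiagonals.
  Reducedness is then clear. The irreducible components are the polydiagonals, since none of them
  contains another and each is irreducible: every point of a polydiagonal has a chart in which the
  polydiagonal is a linear subspace that meets the affine chart.\<close>

section \<open>Polynomials on linear subspaces given by equal coordinates\<close>

text \<open>The linear subspace on which coordinates with the same image under \<open>r\<close> agree, for an idempotent
  \<open>r\<close> that sends every index to a representative of its block.\<close>
definition flat :: "('v \<Rightarrow> 'v) \<Rightarrow> ('v \<Rightarrow> complex) set" where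
  "flat r = {x. x \<circ> r = x}"

lemma eval_poly_on_line:
  fixes x x' :: "'v::finite \<Rightarrow> complex"
  shows "\<exists>P. \<forall>t. poly P t = eval_poly (\<lambda>l. x l + t * (x' l - x l)) p"
proof
  show "\<forall>t. poly (\<Sum>m\<in>Poly_Mapping.keys p. [:Poly_Mapping.lookup p m:] *
      (\<Prod>v\<in>UNIV. [:x v, x' v - x v:] ^ Poly_Mapping.lookup m v)) t =
      eval_poly (\<lambda>l. x l + t * (x' l - x l)) p"
    by (simp add: eval_poly_alt poly_sum poly_prod)
qed

text \<open>A nonzero polynomial function on the line through two points has only finitely many zeros.\<close>
lemma flat_irreducible:
  fixes x x' :: "'v::finite \<Rightarrow> complex"
  assumes x: "x \<in> flat r" "eval_poly x p \<noteq> 0" and x': "x' \<in> flat r" "eval_poly x' q \<noteq> 0"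
  obtains w where "w \<in> flat r" "eval_poly w p \<noteq> 0" "eval_poly w q \<noteq> 0"
proof -
  let ?w = "\<lambda>t l. x l + t * (x' l - x l)"
  obtain P Q where P: "\<And>t. poly P t = eval_poly (?w t) p" and Q: "\<And>t. poly Q t = eval_poly (?w t) q"
    using eval_poly_on_line[of x x' p] eval_poly_on_line[of x x' q] by auto
  have "P \<noteq> 0" using P[of 0] x by auto
  moreover have "Q \<noteq> 0" using Q[of 1] x' by auto
  ultimately have "finite {t. poly (P * Q) t = 0}" by (intro poly_roots_finite) simp
  then obtain t where t: "poly (P * Q) t \<noteq> 0"
    using infinite_UNIV_char_0[where 'a=complex] ex_new_if_finite by blast
  show thesis
  proof (rule that[of "?w t"])
    show "?w t \<in> flat r"
      using x(1) x'(1) by (auto simp: flat_def fun_eq_iff)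
    show "eval_poly (?w t) p \<noteq> 0" "eval_poly (?w t) q \<noteq> 0"
      using t by (simp_all add: P Q)
  qed
qed

lemma flat_cancel:
  fixes p q :: "'v::finite cpoly"
  assumes "\<And>x. x \<in> flat r \<Longrightarrow> eval_poly x (p * q) = 0" "x' \<in> flat r" "eval_poly x' q \<noteq> 0" "x \<in> flat r"
  shows "eval_poly x p = 0"
proof (rule ccontr)
  assume "eval_poly x p \<noteq> 0"
  then obtain w where "w \<in> flat r" "eval_poly w p \<noteq> 0" "eval_poly w q \<noteq> 0"
    using flat_irreducible assms(2-4) by blast
  with assms(1)[of w] show False by simp
qed

lemma cpoly_eqI_all:
  fixes p q :: "'v::finite cpoly"
  assumes "\<And>x. eval_poly x p = eval_poly x q"
  shows "p = q"
  using assms cpoly_eqI by blast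

lemma cpoly_as_monomials:
  fixes p :: "'v::finite cpoly"
  shows "p = (\<Sum>m\<in>Poly_Mapping.keys p. Poly_Mapping.single 0 (Poly_Mapping.lookup p m) *
     (\<Prod>v\<in>UNIV. Var v ^ Poly_Mapping.lookup m v))"
  by (rule cpoly_eqI_all) (simp add: eval_poly_alt[of _ p])

definition rename :: "('v \<Rightarrow> 'v) \<Rightarrow> 'v::finite cpoly \<Rightarrow> 'v cpoly" where
  "rename r p = (\<Sum>m\<in>Poly_Mapping.keys p. Poly_Mapping.single 0 (Poly_Mapping.lookup p m) *
     (\<Prod>v\<in>UNIV. Var (r v) ^ Poly_Mapping.lookup m v))"

lemma eval_rename [simp]: "eval_poly x (rename r p) = eval_poly (x \<circ> r) p"
  unfolding rename_def by (simp add: eval_poly_alt[of _ p])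

lemma rename_cong:
  fixes p :: "letter cpoly"
  assumes J: "cpoly_ideal.subspace J" and r: "\<And>l. Var l - Var (r l) \<in> J"
  shows "p - rename r p \<in> J"
proof -
  note add = cpoly_ideal.subspace_add[OF J] and scale = cpoly_ideal.subspace_scale[OF J]
  have mult: "a * b - a' * b' \<in> J" if "a - a' \<in> J" "b - b' \<in> J" for a a' b b' :: "letter cpoly"
    using add[OF scale[OF that(1), of b] scale[OF that(2), of a']] by (simp add: algebra_simps)
  have pow: "a ^ n - a' ^ n \<in> J" if "a - a' \<in> J" for a a' :: "letter cpoly" and n
    by (induction n) (auto intro: mult that cpoly_ideal.subspace_0[OF J])
  have prod: "(\<Prod>v\<in>A. g v) - (\<Prod>v\<in>A. g' v) \<in> J" if "\<And>v. g v - g' v \<in> J"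
    for g g' :: "letter \<Rightarrow> letter cpoly" and A
    by (induction A rule: infinite_finite_induct) (auto intro: mult that cpoly_ideal.subspace_0[OF J])
  have "p - rename r p = (\<Sum>m\<in>Poly_Mapping.keys p. Poly_Mapping.single 0 (Poly_Mapping.lookup p m) *
     ((\<Prod>v\<in>UNIV. Var v ^ Poly_Mapping.lookup m v) - (\<Prod>v\<in>UNIV. Var (r v) ^ Poly_Mapping.lookup m v)))"
    by (subst (1) cpoly_as_monomials[of p]) (simp only: rename_def right_diff_distrib sum_subtractf)
  also have "\<dots> \<in> J"
    by (intro cpoly_ideal.subspace_sum[OF J] scale prod pow r)
  finally show ?thesis .
qed

text \<open>Modulo the differences \<open>Var l - Var (r l)\<close> every polynomial agrees with its renaming along \<open>r\<close>,
  and the renaming of a polynomial that vanishes on the subspace is zero.\<close>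
lemma vanishing_ideal_flat:
  fixes p :: "letter cpoly"
  assumes "\<And>x. x \<in> flat r \<Longrightarrow> eval_poly x p = 0" "r \<circ> r = r"
    and G: "\<And>l. Var l - Var (r l) \<in> insert 0 G"
  shows "p \<in> cpoly_ideal.span G"
proof -
  have "rename r p = 0"
    by (rule cpoly_eq_0) (use assms(1,2) in \<open>auto simp: flat_def comp_assoc\<close>)
  moreover have "p - rename r p \<in> cpoly_ideal.span G"
    by (rule rename_cong[OF cpoly_ideal.subspace_span])
       (metis G insert_iff cpoly_ideal.span_base cpoly_ideal.span_zero)
  ultimately show ?thesis by simp
qed

lemma span_pair:
  fixes g h :: "letter cpoly"
  assumes "p \<in> cpoly_ideal.span {g, h}"
  obtains \<alpha> \<beta> where "p = \<alpha> * g + \<beta> * h"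
proof -
  obtain \<alpha> where "p - \<alpha> * g \<in> cpoly_ideal.span {h}"
    using assms cpoly_ideal.span_breakdown_eq by blast
  then obtain \<beta> where "p - \<alpha> * g - \<beta> * h \<in> cpoly_ideal.span {}"
    using cpoly_ideal.span_breakdown_eq by blast
  then have "p = \<alpha> * g + \<beta> * h" by (simp add: algebra_simps)
  then show thesis by (rule that)
qed

lemma span_triple:
  fixes g h k :: "letter cpoly"
  assumes "p \<in> cpoly_ideal.span {g, h, k}"
  obtains \<alpha> \<beta> \<gamma> where "p = \<alpha> * g + \<beta> * h + \<gamma> * k"
proof -
  obtain \<alpha> where "p - \<alpha> * g \<in> cpoly_ideal.span {h, k}"
    using assms cpoly_ideal.span_breakdown_eq by blast
  then obtain \<beta> \<gamma> where "p - \<alpha> * g = \<beta> * h + \<gamma> * k" by (rule span_pair)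
  then have "p = \<alpha> * g + \<beta> * h + \<gamma> * k" by (simp add: algebra_simps)
  then show thesis by (rule that)
qed


text \<open>The ideals \<open>(g, h)\<close> and \<open>(k, m)\<close> intersect in their product when \<open>g\<close> and \<open>h\<close> are unaffected by
  the retraction onto the zeros of \<open>k\<close> and \<open>m\<close>: replacing the coefficients of \<open>g\<close> and \<open>h\<close> by their
  renamings gives a combination that is zero, since the polynomial vanishes there.\<close>
lemma disjoint_intersection:
  fixes p :: "letter cpoly"
  assumes p: "p = \<alpha> * g + \<beta> * h" "\<And>x. x \<in> flat r \<Longrightarrow> eval_poly x p = 0"
    and r: "r \<circ> r = r" "\<And>l. Var l - Var (r l) \<in> {0, k, m}"
    and inv: "\<And>x. eval_poly (x \<circ> r) g = eval_poly x g" "\<And>x. eval_poly (x \<circ> r) h = eval_poly x h"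
  obtains A B C D where "p = A * (g * k) + B * (g * m) + C * (h * k) + D * (h * m)"
proof -
  have dec: "\<exists>A B. q = rename r q + A * k + B * m" for q
  proof -
    have "q - rename r q \<in> cpoly_ideal.span {k, m}"
      by (rule rename_cong[OF cpoly_ideal.subspace_span])
         (metis r(2) insert_iff cpoly_ideal.span_base cpoly_ideal.span_zero)
    then obtain A B where "q - rename r q = A * k + B * m" by (rule span_pair)
    then show ?thesis by (intro exI[of _ A] exI[of _ B]) (simp add: algebra_simps)
  qed
  obtain A B where \<alpha>: "\<alpha> = rename r \<alpha> + A * k + B * m" using dec by blast
  obtain C D where \<beta>: "\<beta> = rename r \<beta> + C * k + D * m" using dec by blast
  have "rename r \<alpha> * g + rename r \<beta> * h = 0"
  proof (rule cpoly_eq_0)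
    fix x :: "letter \<Rightarrow> complex"
    have "x \<circ> r \<in> flat r" by (simp add: flat_def comp_assoc r)
    from p(2)[OF this] show "eval_poly x (rename r \<alpha> * g + rename r \<beta> * h) = 0"
      by (simp add: p(1) inv)
  qed
  moreover have "\<alpha> * g = rename r \<alpha> * g + (A * (g * k) + B * (g * m))"
    by (subst \<alpha>) (simp only: distrib_right distrib_left mult_ac add_ac)
  moreover have "\<beta> * h = rename r \<beta> * h + (C * (h * k) + D * (h * m))"
    by (subst \<beta>) (simp only: distrib_right distrib_left mult_ac add_ac)
  ultimately have "p = A * (g * k) + B * (g * m) + C * (h * k) + D * (h * m)"
    unfolding p(1) by (simp add: add_ac)
  then show thesis by (rule that)
qed

section \<open>The ideal on the affine chart\<close>

text \<open>The six partitions, in the order of the theorem, each given by a choice of representatives. The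
  representatives are chosen such that the differences \<open>Var l - Var (r l)\<close> are, up to sign, the
  linear forms used as generators below.\<close>
definition retractions :: "(letter \<Rightarrow> letter) set" where
  "retractions = {id(LA := LC, LB := LC), id(LE := LD, LF := LD), id(LA := LB, LF := LE),
     id(LB := LC, LE := LD), id(LC := LA, LD := LF), id(LA := LF, LB := LE, LC := LD)}"

lemma letter_all: "(\<forall>l. P l) \<longleftrightarrow> P LA \<and> P LB \<and> P LC \<and> P LD \<and> P LE \<and> P LF"
  using letter.exhaust by metis

text \<open>With \<open>U(v) = u\<^sub>0 + u\<^sub>1 v + u\<^sub>2 v\<^sup>2\<close>, the quartic members come from factorizations such as
  \<open>U(e) = - (b - e) y x' z'\<close>, which reflect that the Pascal line contains one of the six points
  only if some of the points coincide. The quadratic generator \<open>u\<^sub>2\<close> is used to exchange \<open>x y'\<close>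
  with \<open>y x'\<close>, and the cubic one is a divided difference of \<open>U\<close>.\<close>
lemma pascal_ideal_members:
  fixes a b c d e f x y z x' y' z' :: "letter cpoly"
  defines "a \<equiv> Var LA" and "b \<equiv> Var LB" and "c \<equiv> Var LC"
    and "d \<equiv> Var LD" and "e \<equiv> Var LE" and "f \<equiv> Var LF"
  defines "x \<equiv> b - c" and "y \<equiv> c - a" and "z \<equiv> a - b"
    and "x' \<equiv> e - d" and "y' \<equiv> d - f" and "z' \<equiv> f - e"
  shows "x * y' - y * x' = u2"
    and "y * x' * (z - z') = - (u1 + (a + e) * u2)"
    and "(a - f) * (y * x' * z') = - (u0 + f * u1 + f^2 * u2) - (a - f) * z' * u2"
    and "(b - e) * (y * x' * z') = - (u0 + e * u1 + e^2 * u2)"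
    and "(c - d) * (y * x' * z') = - (u0 + d * u1 + d^2 * u2) + (c - d) * x' * u2"
  unfolding u0_def u1_def u2_def Let_def x_def y_def z_def x'_def y'_def z'_def a_def b_def c_def d_def e_def f_def
  by - (rule cpoly_eqI_all, simp only: eval_poly_simps eval_poly_minus eval_poly_power, algebra)+

text \<open>If \<open>\<alpha>\<close> lies in \<open>(y, y')\<close> and \<open>\<delta>\<close> in \<open>(x, x')\<close>, then \<open>\<alpha> x x'\<close> and \<open>\<delta> y y'\<close> are combinations of
  \<open>x y'\<close> and \<open>y x'\<close>.\<close>
lemma regroup_disjoint_products:
  fixes x y x' y' :: "'a::comm_ring_1"
  assumes "p = \<alpha> * (x * x') + \<beta> * (x * (- y')) + \<gamma> * (- y * x') + \<delta> * (- y * (- y'))"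
    and "\<alpha> = \<alpha>1 * y + \<alpha>2 * y'" "\<delta> = \<delta>1 * x + \<delta>2 * x'"
  shows "p = (- \<beta> + \<alpha>2 * x' + \<delta>1 * y) * (x * y') + (- \<gamma> + \<alpha>1 * x + \<delta>2 * y') * (y * x')"
  unfolding assms by (simp add: algebra_simps)

lemma regroup_determinant:
  fixes x y x' y' z z' :: "'a::comm_ring_1"
  assumes "p = \<beta> * (x * y') + \<gamma> * (y * x')" and "\<beta> + \<gamma> = s * z + t * z'"
  shows "p = \<beta> * (x * y' - y * x') + s * (y * x' * (z - z')) + (s + t) * (y * x' * z')"
proof -
  have \<gamma>: "\<gamma> = s * z + t * z' - \<beta>" using assms(2) by (simp add: algebra_simps)
  show ?thesis unfolding assms(1) \<gamma> by (simp add: algebra_simps)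
qed

text \<open>The six conditions are imposed one after another, in the order 1, 2, 4, 5, 3, 6. Each
  cancellation requires a point of the subspace at which the factor to be cancelled does not
  vanish; these are the points \<open>w3\<close> to \<open>w6\<close>.\<close>
lemma vanishing_on_diagonals_imp_pascal_ideal:
  assumes p: "\<And>r w. r \<in> retractions \<Longrightarrow> w \<in> flat r \<Longrightarrow> eval_poly w p = 0"
  shows "p \<in> cpoly_ideal.span {u0, u1, u2}"
proof -
  define a b c d e f where
    letters: "a = Var LA" "b = Var LB" "c = Var LC" "d = Var LD" "e = Var LE" "f = Var LF"
  define x y z where xyz: "x = b - c" "y = c - a" "z = a - b"
  define x' y' z' where xyz': "x' = e - d" "y' = d - f" "z' = f - e"
  note defs = letters xyz xyz'
  let ?r1 = "id(LA := LC, LB := LC)" and ?r2 = "id(LE := LD, LF := LD)" and ?r3 = "id(LA := LB, LF := LE)"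
    and ?r4 = "id(LB := LC, LE := LD)" and ?r5 = "id(LC := LA, LD := LF)" and ?r6 = "id(LA := LF, LB := LE, LC := LD)"
  have idem: "?r1 \<circ> ?r1 = ?r1" "?r2 \<circ> ?r2 = ?r2" "?r3 \<circ> ?r3 = ?r3" "?r4 \<circ> ?r4 = ?r4"
    "?r5 \<circ> ?r5 = ?r5" "?r6 \<circ> ?r6 = ?r6"
    by (simp_all add: fun_eq_iff)
  have van: "eval_poly w p = 0" if "w \<in> flat ?r1 \<or> w \<in> flat ?r2 \<or> w \<in> flat ?r3 \<or> w \<in> flat ?r4
     \<or> w \<in> flat ?r5 \<or> w \<in> flat ?r6" for w
    using that p by (auto simp: retractions_def)
  have "p \<in> cpoly_ideal.span {x, - y}"
    by (rule vanishing_ideal_flat[of ?r1]) (use van idem in \<open>auto simp: defs split: if_splits\<close>)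
  then obtain A B where "p = A * x + B * (- y)" by (rule span_pair)
  then obtain \<alpha> \<beta> \<gamma> \<delta> where 12: "p = \<alpha> * (x * x') + \<beta> * (x * (- y')) + \<gamma> * (- y * x') + \<delta> * (- y * (- y'))"
    by (rule disjoint_intersection[where r = ?r2 and k = x' and m = "- y'"])
      (use van idem in \<open>auto simp: defs split: if_splits\<close>)
  define w4 :: "letter \<Rightarrow> complex" where "w4 = (\<lambda>_. 0)(LA := 1, LF := 1)"
  have "eval_poly w \<delta> = 0" if "w \<in> flat ?r4" for w
    using _ _ _ that
  proof (rule flat_cancel[of ?r4 \<delta> "y * y'"])
    show "w4 \<in> flat ?r4" "eval_poly w4 (y * y') \<noteq> 0" by (simp_all add: flat_def fun_eq_iff w4_def defs)
    fix v assume v: "v \<in> flat ?r4"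
    then have "v LB = v LC" "v LE = v LD" by (auto simp: flat_def fun_eq_iff letter_all)
    then show "eval_poly v (\<delta> * (y * y')) = 0"
      using van[of v] v unfolding 12 by (auto simp: defs)
  qed
  then have "\<delta> \<in> cpoly_ideal.span {x, x'}"
    by (rule vanishing_ideal_flat[of ?r4]) (use idem in \<open>auto simp: defs split: if_splits\<close>)
  then obtain \<delta>1 \<delta>2 where \<delta>: "\<delta> = \<delta>1 * x + \<delta>2 * x'" by (rule span_pair)
  define w5 :: "letter \<Rightarrow> complex" where "w5 = (\<lambda>_. 0)(LB := 1, LE := 1)"
  have "eval_poly w \<alpha> = 0" if "w \<in> flat ?r5" for w
    using _ _ _ that
  proof (rule flat_cancel[of ?r5 \<alpha> "x * x'"])
    show "w5 \<in> flat ?r5" "eval_poly w5 (x * x') \<noteq> 0" by (simp_all add: flat_def fun_eq_iff w5_def defs)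
    fix v assume v: "v \<in> flat ?r5"
    then have "v LC = v LA" "v LD = v LF" by (auto simp: flat_def fun_eq_iff letter_all)
    then show "eval_poly v (\<alpha> * (x * x')) = 0"
      using van[of v] v unfolding 12 by (auto simp: defs)
  qed
  then have "\<alpha> \<in> cpoly_ideal.span {y, y'}"
    by (rule vanishing_ideal_flat[of ?r5]) (use idem in \<open>auto simp: defs split: if_splits\<close>)
  then obtain \<alpha>1 \<alpha>2 where \<alpha>: "\<alpha> = \<alpha>1 * y + \<alpha>2 * y'" by (rule span_pair)
  obtain \<beta>' \<gamma>' where 1245: "p = \<beta>' * (x * y') + \<gamma>' * (y * x')"
    using regroup_disjoint_products[OF 12 \<alpha> \<delta>] that by blast
  define w3 :: "letter \<Rightarrow> complex" where "w3 = (\<lambda>_. 0)(LC := 1, LD := 1)"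
  have "eval_poly w (\<beta>' + \<gamma>') = 0" if "w \<in> flat ?r3" for w
    using _ _ _ that
  proof (rule flat_cancel[of ?r3 "\<beta>' + \<gamma>'" "x * x'"])
    show "w3 \<in> flat ?r3" "eval_poly w3 (x * x') \<noteq> 0" by (simp_all add: flat_def fun_eq_iff w3_def defs)
    fix v assume v: "v \<in> flat ?r3"
    then have e: "v LA = v LB" "v LF = v LE" by (auto simp: flat_def fun_eq_iff letter_all)
    have "eval_poly v p = - eval_poly v ((\<beta>' + \<gamma>') * (x * x'))"
      by (subst 1245) (simp add: defs e, simp add: algebra_simps)
    then show "eval_poly v ((\<beta>' + \<gamma>') * (x * x')) = 0" using van[of v] v by simp
  qed
  then have "\<beta>' + \<gamma>' \<in> cpoly_ideal.span {z, z'}"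
    by (rule vanishing_ideal_flat[of ?r3]) (use idem in \<open>auto simp: defs split: if_splits\<close>)
  then obtain s t where st: "\<beta>' + \<gamma>' = s * z + t * z'" by (rule span_pair)
  have 12345: "p = \<beta>' * (x * y' - y * x') + s * (y * x' * (z - z')) + (s + t) * (y * x' * z')"
    by (rule regroup_determinant[OF 1245 st])
  define w6 :: "letter \<Rightarrow> complex" where "w6 = (\<lambda>_. 0)(LB := 1, LE := 1, LC := 2, LD := 2)"
  have "eval_poly w (s + t) = 0" if "w \<in> flat ?r6" for w
    using _ _ _ that
  proof (rule flat_cancel[of ?r6 "s + t" "y * x' * z'"])
    show "w6 \<in> flat ?r6" "eval_poly w6 (y * x' * z') \<noteq> 0" by (simp_all add: flat_def fun_eq_iff w6_def defs)
    fix v assume v: "v \<in> flat ?r6"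
    then have e: "v LA = v LF" "v LB = v LE" "v LC = v LD" by (auto simp: flat_def fun_eq_iff letter_all)
    have "eval_poly v p = eval_poly v ((s + t) * (y * x' * z'))"
      by (subst 12345) (simp add: defs e)
    then show "eval_poly v ((s + t) * (y * x' * z')) = 0" using van[of v] v by simp
  qed
  then have "s + t \<in> cpoly_ideal.span {a - f, b - e, c - d}"
    by (rule vanishing_ideal_flat[of ?r6]) (use idem in \<open>auto simp: defs split: if_splits\<close>)
  then obtain k l m where klm: "s + t = k * (a - f) + l * (b - e) + m * (c - d)" by (rule span_triple)
  have p': "p = \<beta>' * (x * y' - y * x') + s * (y * x' * (z - z')) +
      k * ((a - f) * (y * x' * z')) + l * ((b - e) * (y * x' * z')) + m * ((c - d) * (y * x' * z'))"
    by (subst 12345, subst klm) (simp only: distrib_right mult.assoc add.assoc)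
  have u: "u0 \<in> cpoly_ideal.span {u0, u1, u2}" "u1 \<in> cpoly_ideal.span {u0, u1, u2}"
    "u2 \<in> cpoly_ideal.span {u0, u1, u2}"
    by (auto intro: cpoly_ideal.span_base)
  show ?thesis
    by (subst p', unfold pascal_ideal_members[folded letters, folded xyz xyz'])
       (intro cpoly_ideal.span_add cpoly_ideal.span_diff cpoly_ideal.span_neg cpoly_ideal.span_scale u)
qed

section \<open>The three forms on the charts\<close>

lemma pascal_form_homogeneous:
  fixes z w :: "hcoord \<Rightarrow> complex"
  assumes "F \<in> pascal_forms"
    and "\<And>l. z (HS l) = \<rho> l * w (HS l)" "\<And>l. z (HT l) = \<rho> l * w (HT l)"
  shows "eval_poly z F = (\<Prod>l\<in>UNIV. \<rho> l) * eval_poly w F"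
proof -
  have P: "(\<Prod>l\<in>UNIV. \<rho> l) = \<rho> LA * \<rho> LB * \<rho> LC * \<rho> LD * \<rho> LE * \<rho> LF"
    by (simp add: letter_UNIV mult_ac)
  show ?thesis
    using assms(1) unfolding pascal_forms_def P
    apply (simp only: image_insert image_empty insert_iff empty_iff)
    apply (elim disjE; simp only: eval_pascal_forms assms(2,3))
       apply (simp_all add: algebra_simps)
    done
qed

lemma pascal_form_vanishes:
  fixes z :: "hcoord \<Rightarrow> complex"
  assumes "F \<in> pascal_forms" "r \<in> retractions"
    and "\<And>l. z (HS l) = z (HS (r l))" "\<And>l. z (HT l) = z (HT (r l))"
  shows "eval_poly z F = 0"
proof -
  have S: "\<forall>l. z (HS l) = z (HS (r l))" and T: "\<forall>l. z (HT l) = z (HT (r l))" using assms(3,4) by blast+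
  show ?thesis
    using assms(1,2) S T unfolding pascal_forms_def retractions_def
    apply (simp only: image_insert image_empty insert_iff empty_iff)
    apply (elim disjE; simp only: letter_all eval_pascal_forms; simp add: algebra_simps)
    done
qed

text \<open>The substitution \<open>[s, v] \<mapsto> [s - t v, v]\<close> in all six factors is induced by a projectivity of the
  plane that preserves the conic; this projectivity maps Pascal lines to Pascal lines, so it acts
  linearly on the three forms.\<close>
lemma pascal_forms_shear:
  fixes z w :: "hcoord \<Rightarrow> complex"
  assumes "\<And>l. w (HS l) = z (HS l) - t * z (HT l)" "\<And>l. w (HT l) = z (HT l)"
  defines "U \<equiv> \<lambda>z u. eval_poly z (multihomogenize (\<lambda>_. 1) u)"
  shows "U w u0 = U z u0"
    and "U w u1 = U z u1 + 2 * t * U z u0"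
    and "U w u2 = U z u2 + t * U z u1 + t^2 * U z u0"
  unfolding U_def eval_pascal_forms assms(1,2) by algebra+

lemma eval_pascal_coefficient:
  assumes "\<And>l. z (HS l) = 1" "\<And>l. z (HT l) = y l" "u \<in> {u0, u1, u2}"
  shows "eval_poly y u = eval_poly z (multihomogenize (\<lambda>_. 1) u)"
  using assms(3) by (elim insertE emptyE; simp only: eval_pascal_forms assms(1,2)) (simp_all add: u0_def u1_def u2_def Let_def)

lemma clear_denominators:
  fixes p :: "'v::finite cpoly" and num den :: "'v \<Rightarrow> 'w::finite cpoly"
  shows "\<exists>K q. \<forall>y. (\<forall>l. eval_poly y (den l) \<noteq> 0) \<longrightarrow>
    eval_poly y q = (\<Prod>l\<in>UNIV. eval_poly y (den l)) ^ K * eval_poly (\<lambda>l. eval_poly y (num l) / eval_poly y (den l)) p"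
proof -
  define K where "K = (\<Sum>m\<in>Poly_Mapping.keys p. \<Sum>v\<in>UNIV. Poly_Mapping.lookup m v)"
  have K: "Poly_Mapping.lookup m v \<le> K" if "m \<in> Poly_Mapping.keys p" for m v
  proof -
    have "Poly_Mapping.lookup m v \<le> (\<Sum>v\<in>UNIV. Poly_Mapping.lookup m v)"
      by (rule member_le_sum) auto
    also have "\<dots> \<le> K"
      unfolding K_def by (rule member_le_sum) (use that in auto)
    finally show ?thesis .
  qed
  define q where "q = (\<Sum>m\<in>Poly_Mapping.keys p. Poly_Mapping.single 0 (Poly_Mapping.lookup p m) *
     (\<Prod>l\<in>UNIV. num l ^ Poly_Mapping.lookup m l * den l ^ (K - Poly_Mapping.lookup m l)))"
  have "eval_poly y q = (\<Prod>l\<in>UNIV. eval_poly y (den l)) ^ K * eval_poly (\<lambda>l. eval_poly y (num l) / eval_poly y (den l)) p"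
    if y: "\<forall>l. eval_poly y (den l) \<noteq> 0" for y
  proof -
    have "(\<Prod>l\<in>UNIV. eval_poly y (num l) ^ Poly_Mapping.lookup m l * eval_poly y (den l) ^ (K - Poly_Mapping.lookup m l)) =
       (\<Prod>l\<in>UNIV. eval_poly y (den l)) ^ K *
       (\<Prod>l\<in>UNIV. (eval_poly y (num l) / eval_poly y (den l)) ^ Poly_Mapping.lookup m l)"
      if m: "m \<in> Poly_Mapping.keys p" for m
      unfolding prod_power_distrib prod.distrib[symmetric]
      by (rule prod.cong[OF refl]) (use y K[OF m] in \<open>auto simp: power_diff field_simps\<close>)
    then show ?thesis
      unfolding q_def by (simp add: eval_poly_alt[of _ p] sum_distrib_left mult_ac)
  qed
  then show ?thesis by blast
qed

section \<open>Points in the charts\<close>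

text \<open>The determinant of homogeneous coordinates that vanishes when the points with letters \<open>l\<close> and
  \<open>m\<close> coincide, whether or not their coordinates come from the same chart of the conic.\<close>
definition bracket :: "chart \<Rightarrow> letter \<Rightarrow> letter \<Rightarrow> letter cpoly" where
  "bracket \<sigma> l m = chart_coord \<sigma> (HS l) * chart_coord \<sigma> (HT m) - chart_coord \<sigma> (HT l) * chart_coord \<sigma> (HS m)"

lemma chart_map_eq_cpt:
  "chart_map \<sigma> x l = abs_p2 (cpt (eval_poly x (chart_coord \<sigma> (HS l))) (eval_poly x (chart_coord \<sigma> (HT l))))"
  by (simp add: chart_map_def conic_point_def chart_coord_def cpt_def)

lemma abs_p2_eqD:
  assumes "abs_p2 v = abs_p2 w" "v \<noteq> 0" "w \<noteq> 0"
  obtains c where "w = c *s v"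
proof -
  have "u \<noteq> 0 \<and> (\<exists>c. c \<noteq> 0 \<and> u = c *s u)" if "u \<noteq> 0" for u :: "complex ^ 3"
    using that by (auto intro!: exI[of _ 1])
  then have "v \<noteq> 0 \<and> (\<exists>c. c \<noteq> 0 \<and> w = c *s v)"
    using Quotient_rel[OF Quotient_p2, of v w] assms by auto
  with that show thesis by blast
qed

lemma chart_map_eq_iff:
  "chart_map \<sigma> x l = chart_map \<sigma> x m \<longleftrightarrow> eval_poly x (bracket \<sigma> l m) = 0"
proof -
  define s t s' t' where
    st: "s = eval_poly x (chart_coord \<sigma> (HS l))" "t = eval_poly x (chart_coord \<sigma> (HT l))"
      "s' = eval_poly x (chart_coord \<sigma> (HS m))" "t' = eval_poly x (chart_coord \<sigma> (HT m))"
  have nz: "cpt s t \<noteq> 0" "cpt s' t' \<noteq> 0"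
    by (rule cpt_nz, simp add: st chart_coord_def)+
  have "abs_p2 (cpt s t) = abs_p2 (cpt s' t') \<longleftrightarrow> s * t' - t * s' = 0"
  proof
    assume "abs_p2 (cpt s t) = abs_p2 (cpt s' t')"
    then obtain k where k: "cpt s' t' = k *s cpt s t"
      using nz by (rule abs_p2_eqD)
    then have "s'^2 = k * s^2" "s' * t' = k * (s * t)" "t'^2 = k * t^2"
      by (simp_all add: cpt_def vec3_eq)
    then have "(s * t' - t * s')^2 = 0" by algebra
    then show "s * t' - t * s' = 0" by simp
  next
    assume "s * t' - t * s' = 0"
    then have "cross_c (cpt s t) (cpt s' t') = 0" unfolding cr_cpt by simp
    then show "abs_p2 (cpt s t) = abs_p2 (cpt s' t')" using nz by (rule cr_zero_imp)
  qed
  then show ?thesis by (simp add: chart_map_eq_cpt bracket_def st)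
qed

definition diagonal :: "(letter \<Rightarrow> letter) \<Rightarrow> (letter \<Rightarrow> p2) set" where
  "diagonal r = {h \<in> sextuples. h \<circ> r = h}"

lemma chart_map_in_diagonal:
  "chart_map \<sigma> x \<in> diagonal r \<longleftrightarrow> (\<forall>l. eval_poly x (bracket \<sigma> (r l) l) = 0)"
  by (simp add: diagonal_def chart_map_in_sextuples fun_eq_iff chart_map_eq_iff)

text \<open>By homogeneity, points of the projective line that coincide may be given the same homogeneous
  coordinates, and with equal coordinates the forms cancel termwise.\<close>
lemma indeterminacy_vanishes_on_diagonal:
  assumes "f \<in> indeterminacy_scheme \<sigma>" "r \<in> retractions" "chart_map \<sigma> x \<in> diagonal r"
  shows "eval_poly x f = 0"
proof -
  define z where "z = (\<lambda>v. eval_poly x (chart_coord \<sigma> v))"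
  have idem: "r \<circ> r = r" using assms(2) by (auto simp: retractions_def fun_eq_iff)
  have "\<exists>k. z (HS l) = k * z (HS (r l)) \<and> z (HT l) = k * z (HT (r l))" for l
  proof -
    have "z (HS (r l)) * z (HT l) = z (HT (r l)) * z (HS l)"
      using assms(3) by (auto simp: chart_map_in_diagonal bracket_def z_def)
    moreover have "z (HS (r l)) = 1 \<or> z (HT (r l)) = 1" by (simp add: z_def chart_coord_def)
    ultimately show ?thesis
      by (elim disjE; intro exI[of _ "if z (HS (r l)) = 1 then z (HS l) else z (HT l)"]) (auto simp: mult.commute)
  qed
  then have "\<forall>l. \<exists>k. z (HS l) = k * z (HS (r l)) \<and> z (HT l) = k * z (HT (r l))" by blast
  from choice[OF this] obtain k where "\<forall>l. z (HS l) = k l * z (HS (r l)) \<and> z (HT l) = k l * z (HT (r l))" ..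
  then have k: "\<And>l. z (HS l) = k l * z (HS (r l))" "\<And>l. z (HT l) = k l * z (HT (r l))" by blast+
  define w where "w v = (case v of HS l \<Rightarrow> z (HS (r l)) | HT l \<Rightarrow> z (HT (r l)))" for v
  have rr: "r (r l) = r l" for l using idem by (simp add: fun_eq_iff)
  have F: "eval_poly x (dehomogenize \<sigma> F) = 0" if "F \<in> pascal_forms" for F
  proof -
    have "eval_poly w F = 0"
      by (rule pascal_form_vanishes[OF that assms(2)]) (simp_all add: w_def rr)
    moreover have "eval_poly z F = (\<Prod>l\<in>UNIV. k l) * eval_poly w F"
      by (rule pascal_form_homogeneous[OF that]; simp only: w_def hcoord.case; rule k)
    ultimately show ?thesis by (simp add: eval_dehomogenize z_def)
  qed
  have "f \<in> cpoly_ideal.span (dehomogenize \<sigma> ` pascal_forms)"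
    using assms(1) by (simp add: indeterminacy_scheme_def common_zero_scheme_def)
  then show ?thesis
    by (induction rule: cpoly_ideal.span_induct_alt) (auto simp: F)
qed

section \<open>Localization away from a point of the conic\<close>

abbreviation const_poly :: "complex \<Rightarrow> letter cpoly" where
  "const_poly \<equiv> Poly_Mapping.single 0"

text \<open>The equation on the chart of the locus where the point with letter \<open>l\<close> has parameter \<open>1 / t\<close>.\<close>
definition away_from :: "chart \<Rightarrow> complex \<Rightarrow> letter \<Rightarrow> letter cpoly" where
  "away_from \<sigma> t l = chart_coord \<sigma> (HS l) - const_poly t * chart_coord \<sigma> (HT l)"

lemma eval_away_from:
  "eval_poly x (away_from \<sigma> t l) = (if \<sigma> l then x l - t else 1 - t * x l)"
  by (simp add: away_from_def chart_coord_def)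

text \<open>In terms of the coordinate \<open>y = v / (1 - t v)\<close> the point \<open>\<tau>(v)\<close> is \<open>[1 + t y, y]\<close>, so that its
  position is determined by \<open>y\<close> independently of the chart that is used for its letter.\<close>
lemma chart_map_moebius:
  assumes "(if \<sigma> l then y l else 1 + t * y l) \<noteq> 0"
  shows "chart_map \<sigma> (\<lambda>l. (if \<sigma> l then 1 + t * y l else y l) / (if \<sigma> l then y l else 1 + t * y l)) l
    = abs_p2 (cpt (1 + t * y l) (y l))"
proof -
  let ?k = "inverse (if \<sigma> l then y l else 1 + t * y l)"
  have e: "cpt (?k * (1 + t * y l)) (?k * y l) = ?k^2 *s cpt (1 + t * y l) (y l)"
    by (simp add: cpt_def vec3_eq power2_eq_square)
  have "chart_map \<sigma> (\<lambda>l. (if \<sigma> l then 1 + t * y l else y l) / (if \<sigma> l then y l else 1 + t * y l)) l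
      = abs_p2 (cpt (?k * (1 + t * y l)) (?k * y l))"
    unfolding chart_map_eq_cpt using assms by (cases "\<sigma> l") (auto simp: chart_coord_def field_simps)
  also have "\<dots> = abs_p2 (cpt (1 + t * y l) (y l))"
    unfolding e by (rule abs_p2_eqI, rule cpt_nz) (use assms in \<open>auto split: if_splits\<close>)
  finally show ?thesis .
qed

lemma pascal_coefficient_at_moebius:
  assumes "\<And>l. eval_poly x (away_from \<sigma> t l) \<noteq> 0"
  defines "y \<equiv> \<lambda>l. eval_poly x (chart_coord \<sigma> (HT l)) / eval_poly x (away_from \<sigma> t l)"
    and "G \<equiv> \<Prod>l\<in>UNIV. eval_poly x (away_from \<sigma> t l)"
    and "V \<equiv> \<lambda>u. eval_poly x (dehomogenize \<sigma> (multihomogenize (\<lambda>_. 1) u))"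
  shows "G * eval_poly y u0 = V u0"
    and "G * eval_poly y u1 = V u1 + 2 * t * V u0"
    and "G * eval_poly y u2 = V u2 + t * V u1 + t^2 * V u0"
proof -
  define z where "z = (\<lambda>v. eval_poly x (chart_coord \<sigma> v))"
  define w where "w v = (case v of HS l \<Rightarrow> z (HS l) - t * z (HT l) | HT l \<Rightarrow> z (HT l))" for v
  define o1 where "o1 v = (case v of HS l \<Rightarrow> 1 | HT l \<Rightarrow> y l)" for v
  have V: "V u = eval_poly z (multihomogenize (\<lambda>_. 1) u)" for u
    by (simp add: V_def z_def eval_dehomogenize)
  have G: "G * eval_poly y u = eval_poly w (multihomogenize (\<lambda>_. 1) u)" if "u \<in> {u0, u1, u2}" for u
  proof -
    have "eval_poly w (multihomogenize (\<lambda>_. 1) u) = G * eval_poly o1 (multihomogenize (\<lambda>_. 1) u)"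
      unfolding G_def
      by (rule pascal_form_homogeneous)
         (use that assms(1) in \<open>auto simp: pascal_forms_def w_def o1_def z_def y_def away_from_def\<close>)
    also have "eval_poly o1 (multihomogenize (\<lambda>_. 1) u) = eval_poly y u"
      by (rule eval_pascal_coefficient[symmetric]) (use that in \<open>auto simp: o1_def\<close>)
    finally show ?thesis ..
  qed
  have w: "\<And>l. w (HS l) = z (HS l) - t * z (HT l)" "\<And>l. w (HT l) = z (HT l)"
    by (simp_all add: w_def)
  show "G * eval_poly y u0 = V u0" "G * eval_poly y u1 = V u1 + 2 * t * V u0"
    "G * eval_poly y u2 = V u2 + t * V u1 + t^2 * V u0"
    using pascal_forms_shear[of w z t, OF w] by (simp_all only: G V insert_iff simp_thms)
qed

lemma moebius_inverse:
  assumes "eval_poly x (away_from \<sigma> t l) \<noteq> 0"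
  defines "y \<equiv> \<lambda>l. eval_poly x (chart_coord \<sigma> (HT l)) / eval_poly x (away_from \<sigma> t l)"
  shows "(if \<sigma> l then y l else 1 + t * y l) = inverse (eval_poly x (away_from \<sigma> t l))"
    and "(if \<sigma> l then 1 + t * y l else y l) / (if \<sigma> l then y l else 1 + t * y l) = x l"
  using assms(1) by (auto simp: y_def eval_away_from chart_coord_def field_simps)

text \<open>The function is rewritten in the coordinates \<open>v / (1 - t v)\<close>, where the polydiagonals become
  linear, the affine result is applied, and the resulting combination of \<open>u\<^sub>0\<close>, \<open>u\<^sub>1\<close>, \<open>u\<^sub>2\<close> is
  transported back. Both changes of coordinates introduce denominators, and the ones that remain
  are powers of the factors \<open>away_from\<close>.\<close>
lemma vanishing_on_diagonals_locally:
  assumes f: "\<And>r x. r \<in> retractions \<Longrightarrow> chart_map \<sigma> x \<in> diagonal r \<Longrightarrow> eval_poly x f = 0"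
  shows "\<exists>N. (\<Prod>l\<in>UNIV. away_from \<sigma> t l) ^ N * f \<in> indeterminacy_scheme \<sigma>"
proof -
  define num den :: "letter \<Rightarrow> letter cpoly" where
    "num l = (if \<sigma> l then 1 + const_poly t * Var l else Var l)" and
    "den l = (if \<sigma> l then Var l else 1 + const_poly t * Var l)" for l
  have num: "eval_poly y (num l) = (if \<sigma> l then 1 + t * y l else y l)"
    and den: "eval_poly y (den l) = (if \<sigma> l then y l else 1 + t * y l)" for y l
    by (simp_all add: num_def den_def)
  define \<mu> where "\<mu> y l = eval_poly y (num l) / eval_poly y (den l)" for y l
  obtain K q where q: "\<And>y. (\<forall>l. eval_poly y (den l) \<noteq> 0) \<Longrightarrow>
      eval_poly y q = (\<Prod>l\<in>UNIV. eval_poly y (den l)) ^ K * eval_poly (\<mu> y) f"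
    using clear_denominators[of den num f] unfolding \<mu>_def by blast
  \<comment> \<open>The additional factor makes the polynomial vanish also where a denominator is zero, where \<open>q\<close> is not controlled.\<close>
  have "(\<Prod>l\<in>UNIV. den l) * q \<in> cpoly_ideal.span {u0, u1, u2}"
  proof (rule vanishing_on_diagonals_imp_pascal_ideal)
    fix r y assume r: "r \<in> retractions" and y: "y \<in> flat r"
    show "eval_poly y ((\<Prod>l\<in>UNIV. den l) * q) = 0"
    proof (cases "\<forall>l. eval_poly y (den l) \<noteq> 0")
      case True
      have "chart_map \<sigma> (\<mu> y) l = abs_p2 (cpt (1 + t * y l) (y l))" for l
        using chart_map_moebius[of \<sigma> l y t] True unfolding \<mu>_def num den by simp
      moreover have "y (r l) = y l" for l using y by (auto simp: flat_def fun_eq_iff)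
      ultimately have "chart_map \<sigma> (\<mu> y) \<in> diagonal r"
        by (simp add: diagonal_def chart_map_in_sextuples fun_eq_iff)
      then show ?thesis using f[OF r] q[OF True] by simp
    next
      case False
      then have "(\<Prod>l\<in>UNIV. eval_poly y (den l)) = 0" by (simp add: prod_zero_iff)
      then show ?thesis by simp
    qed
  qed
  then obtain A0 A1 A2 where A: "(\<Prod>l\<in>UNIV. den l) * q = A0 * u0 + A1 * u1 + A2 * u2"
    by (rule span_triple)
  \<comment> \<open>\<open>\<nu>\<close> is inverse to \<open>\<mu>\<close>, and it turns the denominators of \<open>\<mu>\<close> into the reciprocals of those of \<open>\<nu>\<close>.\<close>
  define \<nu> where "\<nu> x l = eval_poly x (chart_coord \<sigma> (HT l)) / eval_poly x (away_from \<sigma> t l)" for x l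
  define G where "G = (\<Prod>l\<in>UNIV. away_from \<sigma> t l)"
  have pull: "\<exists>K B. \<forall>x. eval_poly x G \<noteq> 0 \<longrightarrow> eval_poly x B = eval_poly x G ^ K * eval_poly (\<nu> x) A" for A
    using clear_denominators[of "away_from \<sigma> t" "\<lambda>l. chart_coord \<sigma> (HT l)" A]
    by (simp add: G_def \<nu>_def[abs_def])
  obtain K0 B0 where B0: "\<And>x. eval_poly x G \<noteq> 0 \<Longrightarrow> eval_poly x B0 = eval_poly x G ^ K0 * eval_poly (\<nu> x) A0"
    using pull[of A0] by blast
  obtain K1 B1 where B1: "\<And>x. eval_poly x G \<noteq> 0 \<Longrightarrow> eval_poly x B1 = eval_poly x G ^ K1 * eval_poly (\<nu> x) A1"
    using pull[of A1] by blast
  obtain K2 B2 where B2: "\<And>x. eval_poly x G \<noteq> 0 \<Longrightarrow> eval_poly x B2 = eval_poly x G ^ K2 * eval_poly (\<nu> x) A2"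
    using pull[of A2] by blast
  define F where "F u = dehomogenize \<sigma> (multihomogenize (\<lambda>_. 1) u)" for u
  define v1 v2 where "v1 = F u1 + const_poly (2 * t) * F u0"
    and "v2 = F u2 + const_poly t * F u1 + const_poly (t^2) * F u0"
  define R where "R = G ^ K * (G ^ (K1 + K2) * B0 * F u0 + G ^ (K0 + K2) * B1 * v1 + G ^ (K0 + K1) * B2 * v2)"
  \<comment> \<open>One factor \<open>G\<close> is kept on both sides so that the identity holds also where \<open>G\<close> vanishes.\<close>
  have "G ^ Suc (K0 + K1 + K2) * f = G * R"
  proof (rule cpoly_eqI_all)
    fix x
    show "eval_poly x (G ^ Suc (K0 + K1 + K2) * f) = eval_poly x (G * R)"
    proof (cases "eval_poly x G = 0")
      case False
      define g where "g = eval_poly x G"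
      have g: "g = (\<Prod>l\<in>UNIV. eval_poly x (away_from \<sigma> t l))" by (simp add: g_def G_def)
      have nz: "eval_poly x (away_from \<sigma> t l) \<noteq> 0" for l using False by (simp add: G_def)
      have dn: "eval_poly (\<nu> x) (den l) = inverse (eval_poly x (away_from \<sigma> t l))" for l
        unfolding den \<nu>_def using moebius_inverse(1)[OF nz] by simp
      have "\<mu> (\<nu> x) = x"
        unfolding \<mu>_def num den \<nu>_def by (rule ext) (rule moebius_inverse(2)[OF nz])
      moreover have "(\<Prod>l\<in>UNIV. eval_poly (\<nu> x) (den l)) = inverse g"
        unfolding dn g using prod_inversef[of "\<lambda>l. eval_poly x (away_from \<sigma> t l)" UNIV] by (simp add: comp_def)
      moreover have "\<forall>l. eval_poly (\<nu> x) (den l) \<noteq> 0" using nz by (simp add: dn)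
      ultimately have "eval_poly (\<nu> x) ((\<Prod>l\<in>UNIV. den l) * q) = inverse g ^ Suc K * eval_poly x f"
        using q[of "\<nu> x"] by simp
      moreover have "g \<noteq> 0" using False by (simp add: g_def)
      ultimately have "eval_poly x f = g ^ K * (g * eval_poly (\<nu> x) (A0 * u0 + A1 * u1 + A2 * u2))"
        unfolding A by (simp add: field_simps)
      also have "g * eval_poly (\<nu> x) (A0 * u0 + A1 * u1 + A2 * u2) =
          eval_poly (\<nu> x) A0 * (g * eval_poly (\<nu> x) u0) + eval_poly (\<nu> x) A1 * (g * eval_poly (\<nu> x) u1)
          + eval_poly (\<nu> x) A2 * (g * eval_poly (\<nu> x) u2)"
        by (simp add: algebra_simps)
      also have "\<dots> = eval_poly (\<nu> x) A0 * eval_poly x (F u0) + eval_poly (\<nu> x) A1 * eval_poly x v1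
          + eval_poly (\<nu> x) A2 * eval_poly x v2"
        unfolding g \<nu>_def pascal_coefficient_at_moebius[OF nz] by (simp add: v1_def v2_def F_def)
      finally have "g ^ (K0 + K1 + K2) * eval_poly x f = g ^ K * (g ^ (K0 + K1 + K2) *
         (eval_poly (\<nu> x) A0 * eval_poly x (F u0) + eval_poly (\<nu> x) A1 * eval_poly x v1
          + eval_poly (\<nu> x) A2 * eval_poly x v2))"
        by simp
      also have "\<dots> = eval_poly x R"
        unfolding R_def
        by (simp only: eval_poly_simps eval_poly_power B0[OF False] B1[OF False] B2[OF False] g_def[symmetric] power_add)
          (simp only: distrib_left distrib_right mult_ac)
      finally show ?thesis by (simp add: g_def)
    qed simp
  qed
  moreover have "G * R \<in> indeterminacy_scheme \<sigma>"
  proof -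
    have "F u \<in> indeterminacy_scheme \<sigma>" if "u \<in> {u0, u1, u2}" for u
      unfolding indeterminacy_scheme_def common_zero_scheme_def F_def
      by (rule cpoly_ideal.span_base) (use that in \<open>auto simp: pascal_forms_def\<close>)
    then have Fu: "F u0 \<in> indeterminacy_scheme \<sigma>" "F u1 \<in> indeterminacy_scheme \<sigma>" "F u2 \<in> indeterminacy_scheme \<sigma>"
      by auto
    have J: "cpoly_ideal.subspace (indeterminacy_scheme \<sigma>)"
      by (simp add: indeterminacy_scheme_def common_zero_scheme_def cpoly_ideal.subspace_span)
    show ?thesis
      unfolding R_def v1_def v2_def
      by (intro cpoly_ideal.subspace_scale[OF J] cpoly_ideal.subspace_add[OF J] Fu)
  qed
  ultimately show ?thesis unfolding G_def by metis
qed

section \<open>Comaximal denominators\<close>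

lemma comaximal_power:
  fixes x y :: "'a::comm_ring_1"
  assumes "u * x + v * y = 1"
  shows "\<exists>u v. u * x + v * y ^ n = 1"
proof (induction n)
  case (Suc n)
  then obtain u' v' where e: "u' * x + v' * y ^ n = 1" by blast
  have "1 = (u * x + v * y) * (u' * x + v' * y ^ n)" using assms e by simp
  also have "\<dots> = (u * (u' * x + v' * y ^ n) + v * y * u') * x + (v * v') * y ^ Suc n"
    by (simp add: algebra_simps)
  finally show ?case by metis
qed (auto intro: exI[of _ 0])

lemma comaximal_powers:
  fixes x y :: "'a::comm_ring_1"
  assumes "u * x + v * y = 1"
  obtains u v where "u * x ^ m + v * y ^ n = 1"
  using comaximal_power[OF assms, of n] comaximal_power[of _ "y ^ n" _ x m] that
  by (metis add.commute)

lemma away_from_comaximal: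
  assumes "s \<noteq> t"
  shows "\<exists>u v. u * away_from \<sigma> s l + v * away_from \<sigma> t l = 1"
proof (cases "\<sigma> l")
  case True
  have "const_poly (1 / (t - s)) * away_from \<sigma> s l + const_poly (- 1 / (t - s)) * away_from \<sigma> t l = 1"
    by (rule cpoly_eqI_all) (use assms True in \<open>simp add: eval_away_from divide_simps\<close>)
  then show ?thesis by blast
next
  case False
  have "const_poly (t / (t - s)) * away_from \<sigma> s l + const_poly (- s / (t - s)) * away_from \<sigma> t l = 1"
    by (rule cpoly_eqI_all) (use assms False in \<open>simp add: eval_away_from divide_simps, simp add: algebra_simps\<close>)
  then show ?thesis by blast
qed

lemma colon_ideal:
  assumes J: "cpoly_ideal.subspace J"
  shows "cpoly_ideal.subspace {g. g * p \<in> J}"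
proof (rule cpoly_ideal.subspaceI)
  show "0 \<in> {g. g * p \<in> J}" using cpoly_ideal.subspace_0[OF J] by simp
next
  fix x y assume "x \<in> {g. g * p \<in> J}" "y \<in> {g. g * p \<in> J}"
  then show "x + y \<in> {g. g * p \<in> J}"
    using cpoly_ideal.subspace_add[OF J] by (simp only: mem_Collect_eq distrib_right)
next
  fix c x assume "x \<in> {g. g * p \<in> J}"
  then show "c * x \<in> {g. g * p \<in> J}"
    using cpoly_ideal.subspace_scale[OF J] by (simp only: mem_Collect_eq mult.assoc)
qed

text \<open>Induction over the letters. For a fixed \<open>s\<close>, the powers of the factors of letter \<open>m\<close> at \<open>s\<close> and
  at any other \<open>t\<close> are comaximal, so letter \<open>m\<close> can be removed from the products after
  multiplication by the product at \<open>s\<close>. The induction hypothesis for the colon ideal removes all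
  other \<open>t\<close>, and applied once more it removes \<open>s\<close>.\<close>
lemma away_from_ideal_unit:
  assumes "finite S" "cpoly_ideal.subspace J" "infinite T"
    and "\<And>t. t \<in> T \<Longrightarrow> \<exists>N. (\<Prod>l\<in>S. away_from \<sigma> t l) ^ N \<in> J"
  shows "1 \<in> J"
  using assms
proof (induction S arbitrary: J T rule: finite_induct)
  case empty
  then obtain t where "t \<in> T" by (metis finite.emptyI ex_in_conv)
  with empty.prems(3) show ?case by auto
next
  case (insert m S)
  let ?R = "\<lambda>t. \<Prod>l\<in>S. away_from \<sigma> t l"
  note add = cpoly_ideal.subspace_add[OF insert.prems(1)] and scale = cpoly_ideal.subspace_scale[OF insert.prems(1)]
  have "\<exists>N. ?R s ^ N \<in> J" if s: "s \<in> T" for s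
  proof -
    obtain N where N: "(away_from \<sigma> s m * ?R s) ^ N \<in> J"
      using insert.prems(3)[OF s] unfolding prod.insert[OF insert.hyps] by blast
    define K where "K = {g. g * ?R s ^ N \<in> J}"
    have "1 \<in> K"
    proof (rule insert.IH)
      show "cpoly_ideal.subspace K"
        unfolding K_def by (rule colon_ideal[OF insert.prems(1)])
      show "infinite (T - {s})" using insert.prems(2) by simp
      fix t assume t: "t \<in> T - {s}"
      obtain M where M: "(away_from \<sigma> t m * ?R t) ^ M \<in> J"
        using insert.prems(3)[of t] t unfolding prod.insert[OF insert.hyps] by blast
      obtain u' v' where "u' * away_from \<sigma> s m + v' * away_from \<sigma> t m = 1"
        using away_from_comaximal[of s t \<sigma> m] t by auto
      then obtain u v where uv: "u * away_from \<sigma> s m ^ N + v * away_from \<sigma> t m ^ M = 1"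
        by (rule comaximal_powers)
      have "?R t ^ M * ?R s ^ N = (u * away_from \<sigma> s m ^ N + v * away_from \<sigma> t m ^ M) * (?R t ^ M * ?R s ^ N)"
        unfolding uv by simp
      also have "\<dots> = (u * ?R t ^ M) * (away_from \<sigma> s m * ?R s) ^ N + (v * ?R s ^ N) * (away_from \<sigma> t m * ?R t) ^ M"
        by (simp only: distrib_left distrib_right power_mult_distrib mult_ac)
      also have "\<dots> \<in> J" by (intro add scale N M)
      finally show "\<exists>M. ?R t ^ M \<in> K" unfolding K_def by blast
    qed
    then show ?thesis unfolding K_def by auto
  qed
  then show ?case using insert.IH insert.prems by blast
qed

section \<open>The scheme of base points is reduced\<close>

lemma indeterminacy_scheme_eq_reduced_structure:
  "indeterminacy_scheme = reduced_structure (\<Union>r\<in>retractions. diagonal r)"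
proof (rule ext, rule set_eqI)
  fix \<sigma> f
  have J: "cpoly_ideal.subspace (indeterminacy_scheme \<sigma>)"
    by (simp add: indeterminacy_scheme_def common_zero_scheme_def cpoly_ideal.subspace_span)
  show "f \<in> indeterminacy_scheme \<sigma> \<longleftrightarrow> f \<in> reduced_structure (\<Union>r\<in>retractions. diagonal r) \<sigma>"
  proof
    assume "f \<in> indeterminacy_scheme \<sigma>"
    then show "f \<in> reduced_structure (\<Union>r\<in>retractions. diagonal r) \<sigma>"
      by (auto simp: reduced_structure_def dest: indeterminacy_vanishes_on_diagonal)
  next
    assume f: "f \<in> reduced_structure (\<Union>r\<in>retractions. diagonal r) \<sigma>"
    define K where "K = {g. g * f \<in> indeterminacy_scheme \<sigma>}"
    have "cpoly_ideal.subspace K"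
      unfolding K_def by (rule colon_ideal[OF J])
    moreover have "infinite (UNIV :: complex set)" by (rule infinite_UNIV_char_0)
    moreover have "\<exists>N. (\<Prod>l\<in>UNIV. away_from \<sigma> t l) ^ N \<in> K" for t
      unfolding K_def using f vanishing_on_diagonals_locally[of \<sigma> f t] by (auto simp: reduced_structure_def)
    ultimately have "1 \<in> K" by (intro away_from_ideal_unit[of UNIV K UNIV]) auto
    then show "f \<in> indeterminacy_scheme \<sigma>" by (simp add: K_def)
  qed
qed

section \<open>Reduced structures and their support\<close>

lemma reduced_scheme_reduced_structure: "reduced_scheme (reduced_structure Z)"
  by (auto simp: reduced_scheme_def reduced_structure_def)

lemma scheme_union_reduced_structure:
  "scheme_union (reduced_structure ` \<Z>) = reduced_structure (\<Union>\<Z>)"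
  by (rule ext) (auto simp: scheme_union_def reduced_structure_def)

lemma on_conic_cases:
  assumes "on_conic h"
  obtains b a where "h = conic_point b a"
proof -
  obtain v where v: "v \<noteq> 0" "h = abs_p2 v" by (rule p2_cases)
  have q: "v $ 1 * v $ 3 = (v $ 2)\<^sup>2"
    using assms v unfolding v(2) by (subst (asm) on_conic.abs_eq) (auto intro!: exI[of _ "1::complex"])
  show thesis
  proof (cases "v $ 1 = 0")
    case True
    then have "v $ 2 = 0" using q by simp
    with True v(1) have "v $ 3 \<noteq> 0" by (auto simp: vec3_eq)
    have "v = (v $ 3) *s vector [0\<^sup>2, 0, 1]"
      using True \<open>v $ 2 = 0\<close> by (simp add: vec3_eq)
    then have "h = abs_p2 ((v $ 3) *s vector [0\<^sup>2, 0, 1])" using v(2) by argo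
    also have "\<dots> = conic_point True 0"
      unfolding conic_point_def if_True by (rule abs_p2_eqI) (simp_all add: vec3_eq \<open>v $ 3 \<noteq> 0\<close>)
    finally show thesis by (rule that)
  next
    case False
    define a where "a = v $ 2 / v $ 1"
    have "v = (v $ 1) *s vector [1, a, a\<^sup>2]"
      using False q by (simp add: vec3_eq a_def field_simps power2_eq_square)
    then have "h = abs_p2 ((v $ 1) *s vector [1, a, a\<^sup>2])" using v(2) by argo
    also have "\<dots> = conic_point False a"
      unfolding conic_point_def if_False by (rule abs_p2_eqI) (simp_all add: vec3_eq False)
    finally show thesis by (rule that)
  qed
qed

text \<open>Choosing for every point of the conic one chart and its coordinate there makes the chart of a
  sextuple agree on letters with the same point. In such a chart the polydiagonals through the
  sextuple are linear.\<close>
lemma sextuple_chart: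
  assumes "h \<in> sextuples"
  obtains \<sigma> x where "h = chart_map \<sigma> x" "\<And>r. h \<circ> r = h \<Longrightarrow> \<sigma> \<circ> r = \<sigma> \<and> x \<in> flat r"
proof -
  have "\<forall>p\<in>range h. \<exists>b a. p = conic_point b a"
    using assms on_conic_cases by (metis (mono_tags, lifting) image_iff mem_Collect_eq sextuples_def)
  then obtain \<beta> \<alpha> where "\<forall>p\<in>range h. p = conic_point (\<beta> p) (\<alpha> p)" by metis
  then have "h = chart_map (\<lambda>l. \<beta> (h l)) (\<lambda>l. \<alpha> (h l))"
    by (auto simp: chart_map_def fun_eq_iff)
  moreover have "(\<lambda>l. \<beta> (h l)) \<circ> r = (\<lambda>l. \<beta> (h l)) \<and> (\<lambda>l. \<alpha> (h l)) \<in> flat r" if "h \<circ> r = h" for r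
    using that by (auto simp: flat_def fun_eq_iff)
  ultimately show thesis by (rule that)
qed

lemma support_reduced_structure:
  assumes "zariski_closed Z"
  shows "support (reduced_structure Z) = Z"
proof (intro equalityI subsetI)
  fix h assume "h \<in> support (reduced_structure Z)"
  then obtain \<sigma> x where h: "h = chart_map \<sigma> x" and x: "\<And>f. f \<in> reduced_structure Z \<sigma> \<Longrightarrow> eval_poly x f = 0"
    by (auto simp: support_def)
  obtain P where P: "{x. chart_map \<sigma> x \<in> Z} = {x. \<forall>p\<in>P. eval_poly x p = 0}"
    using assms unfolding zariski_closed_def by blast
  have "P \<subseteq> reduced_structure Z \<sigma>" using P by (auto simp: reduced_structure_def)
  then show "h \<in> Z" using P x h by blast
next
  fix h assume h: "h \<in> Z"
  then have "h \<in> sextuples" using assms by (auto simp: zariski_closed_def)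
  then obtain \<sigma> x where "h = chart_map \<sigma> x" by (rule sextuple_chart)
  with h show "h \<in> support (reduced_structure Z)" by (auto simp: support_def reduced_structure_def)
qed

lemma zariski_closed_diagonal: "zariski_closed (diagonal r)"
  unfolding zariski_closed_def
proof (intro conjI allI)
  fix \<sigma>
  have "{x. chart_map \<sigma> x \<in> diagonal r} = {x. \<forall>p\<in>range (\<lambda>l. bracket \<sigma> (r l) l). eval_poly x p = 0}"
    by (auto simp: chart_map_in_diagonal)
  then show "\<exists>P. {x. chart_map \<sigma> x \<in> diagonal r} = {x. \<forall>p\<in>P. eval_poly x p = 0}" by blast
qed (auto simp: diagonal_def)

lemma zariski_closed_Union:
  assumes "finite \<C>" "\<And>C. C \<in> \<C> \<Longrightarrow> zariski_closed C"
  shows "zariski_closed (\<Union>\<C>)"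
  using assms
proof (induction rule: finite_induct)
  case empty
  show ?case using closedin_empty[of zariski, unfolded closedin_zariski] by simp
next
  case (insert C \<C>)
  then show ?case by (simp add: zariski_closed_Un)
qed

section \<open>Irreducible components\<close>

lemma chart_map_in_diagonal_of_flat:
  assumes "\<sigma> \<circ> r = \<sigma>" "x \<in> flat r"
  shows "chart_map \<sigma> x \<in> diagonal r"
  using assms chart_map_in_sextuples[of \<sigma> x] by (auto simp: diagonal_def chart_map_def flat_def fun_eq_iff)

text \<open>In a chart around a point outside \<open>C\<close> in which the polydiagonal is linear, irreducibility
  provides another such point with all coordinates nonzero, and this one lies in the affine chart.\<close>
lemma diagonal_affine_dense:
  assumes "zariski_closed C" "\<not> diagonal r \<subseteq> C"
  obtains x where "x \<in> flat r" "chart_map (\<lambda>_. False) x \<notin> C"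
proof -
  obtain h where h: "h \<in> sextuples" "h \<circ> r = h" "h \<notin> C" using assms(2) by (auto simp: diagonal_def)
  obtain \<sigma> x where x: "h = chart_map \<sigma> x" "\<sigma> \<circ> r = \<sigma>" "x \<in> flat r"
    using sextuple_chart[OF h(1)] h(2) by metis
  obtain P where P: "{x. chart_map \<sigma> x \<in> C} = {x. \<forall>p\<in>P. eval_poly x p = 0}"
    using assms(1) unfolding zariski_closed_def by blast
  obtain p where p: "p \<in> P" "eval_poly x p \<noteq> 0" using P h(3) x(1) by auto
  have one: "(\<lambda>_. 1) \<in> flat r" "eval_poly (\<lambda>_. 1) (\<Prod>l\<in>UNIV. Var l :: letter cpoly) \<noteq> 0"
    by (simp_all add: flat_def fun_eq_iff)
  obtain w where w: "w \<in> flat r" "eval_poly w p \<noteq> 0" "eval_poly w (\<Prod>l\<in>UNIV. Var l) \<noteq> 0"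
    using flat_irreducible[OF x(3) p(2) one] by blast
  have nz: "w l \<noteq> 0" for l using w(3) by simp
  let ?y = "\<lambda>l. if \<sigma> l then inverse (w l) else w l"
  have "chart_map (\<lambda>_. False) ?y = chart_map \<sigma> w"
    using conic_point_inverse[OF nz, of False] by (auto simp: chart_map_def fun_eq_iff)
  moreover have "chart_map \<sigma> w \<notin> C" using P p(1) w(2) by auto
  moreover have "?y \<in> flat r" using w(1) x(2) by (auto simp: flat_def fun_eq_iff)
  ultimately show thesis using that by metis
qed

lemma diagonal_irreducible:
  assumes "zariski_closed C" "zariski_closed D" "diagonal r \<subseteq> C \<union> D"
  shows "diagonal r \<subseteq> C \<or> diagonal r \<subseteq> D"
proof (rule ccontr)
  let ?\<sigma> = "\<lambda>_::letter. False"
  assume "\<not> (diagonal r \<subseteq> C \<or> diagonal r \<subseteq> D)"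
  then obtain x y where x: "x \<in> flat r" "chart_map ?\<sigma> x \<notin> C" and y: "y \<in> flat r" "chart_map ?\<sigma> y \<notin> D"
    using diagonal_affine_dense[OF assms(1)] diagonal_affine_dense[OF assms(2)] by metis
  obtain P Q where P: "{x. chart_map ?\<sigma> x \<in> C} = {x. \<forall>p\<in>P. eval_poly x p = 0}"
    and Q: "{x. chart_map ?\<sigma> x \<in> D} = {x. \<forall>p\<in>Q. eval_poly x p = 0}"
    using assms(1,2) unfolding zariski_closed_def by (elim conjE allE[where x="?\<sigma>"] exE) (rule that)
  obtain p q where p: "p \<in> P" "eval_poly x p \<noteq> 0" and q: "q \<in> Q" "eval_poly y q \<noteq> 0"
    using P Q x(2) y(2) by blast
  obtain w where w: "w \<in> flat r" "eval_poly w p \<noteq> 0" "eval_poly w q \<noteq> 0"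
    using flat_irreducible[OF x(1) p(2) y(1) q(2)] by blast
  have "chart_map ?\<sigma> w \<notin> C \<union> D" using P Q p(1) q(1) w(2,3) by blast
  moreover have "chart_map ?\<sigma> w \<in> diagonal r"
    by (rule chart_map_in_diagonal_of_flat) (use w in \<open>simp_all add: comp_def\<close>)
  ultimately show False using assms(3) by blast
qed

lemma irreducible_space_diagonal: "irreducible_space (subtopology zariski (diagonal r))"
proof -
  have top: "topspace (subtopology zariski (diagonal r)) = diagonal r"
    by (auto simp: topspace_zariski diagonal_def)
  have "chart_map (\<lambda>_. False) (\<lambda>_. 0) \<in> diagonal r"
    by (rule chart_map_in_diagonal_of_flat) (simp_all add: flat_def comp_def)
  then have "diagonal r \<noteq> {}" by blast
  moreover have "C = diagonal r \<or> D = diagonal r"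
    if C: "closedin (subtopology zariski (diagonal r)) C" and D: "closedin (subtopology zariski (diagonal r)) D"
      and CD: "C \<union> D = diagonal r" for C D
  proof -
    obtain C' D' where "zariski_closed C'" "C = C' \<inter> diagonal r" "zariski_closed D'" "D = D' \<inter> diagonal r"
      using C D by (auto simp: closedin_subtopology closedin_zariski)
    then show ?thesis using diagonal_irreducible[of C' D' r] CD by blast
  qed
  ultimately show ?thesis unfolding irreducible_space_def top by blast
qed

lemma irreducible_subset_of_closed_cover:
  assumes "finite \<Z>" "\<And>Z. Z \<in> \<Z> \<Longrightarrow> closedin X Z"
    and C: "C \<subseteq> topspace X" "irreducible_space (subtopology X C)" and "C \<subseteq> \<Union>\<Z>"
  shows "\<exists>Z\<in>\<Z>. C \<subseteq> Z"
  using assms(1,2,5)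
proof (induction rule: finite_induct)
  case empty
  then show ?case using C by (auto simp: irreducible_space_def)
next
  case (insert Z \<Z>)
  have top: "topspace (subtopology X C) = C" using C(1) by auto
  have "closedin X (\<Union>\<Z>)" using insert by (intro closedin_Union) auto
  then have "closedin (subtopology X C) (C \<inter> Z)" "closedin (subtopology X C) (C \<inter> \<Union>\<Z>)"
    using insert.prems(1)[of Z] by (auto simp: closedin_subtopology)
  moreover have "(C \<inter> Z) \<union> (C \<inter> \<Union>\<Z>) = C" using insert.prems(2) by auto
  ultimately have "C \<inter> Z = C \<or> C \<inter> \<Union>\<Z> = C"
    using C(2) unfolding irreducible_space_def top by blast
  then show ?case using insert by (metis inf.absorb_iff1 insert_iff)
qed

text \<open>Every irreducible subset lies in a member of the cover. A maximal one is therefore a member, and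
  the members are maximal because none contains another.\<close>
lemma irreducible_components_of_cover:
  assumes "finite \<Z>" "\<And>Z. Z \<in> \<Z> \<Longrightarrow> closedin X Z" "topspace X = \<Union>\<Z>"
    and irr: "\<And>Z. Z \<in> \<Z> \<Longrightarrow> irreducible_space (subtopology X Z)"
    and anti: "\<And>Z Z'. Z \<in> \<Z> \<Longrightarrow> Z' \<in> \<Z> \<Longrightarrow> Z \<subseteq> Z' \<Longrightarrow> Z = Z'"
  shows "irreducible_components X = \<Z>"
proof (intro equalityI subsetI)
  fix C assume "C \<in> irreducible_components X"
  then have C: "C \<subseteq> topspace X" "irreducible_space (subtopology X C)"
    and max: "\<And>C'. C \<subseteq> C' \<Longrightarrow> C' \<subseteq> topspace X \<Longrightarrow> irreducible_space (subtopology X C') \<Longrightarrow> C' = C"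
    by (auto simp: irreducible_components_def)
  obtain Z where Z: "Z \<in> \<Z>" "C \<subseteq> Z"
    using irreducible_subset_of_closed_cover[OF assms(1,2) C] C(1) assms(3) by auto
  then have "Z = C" using max[of Z] irr assms(3) by blast
  with Z show "C \<in> \<Z>" by simp
next
  fix Z assume Z: "Z \<in> \<Z>"
  have "C = Z" if C: "Z \<subseteq> C" "C \<subseteq> topspace X" "irreducible_space (subtopology X C)" for C
  proof -
    obtain Z' where "Z' \<in> \<Z>" "C \<subseteq> Z'"
      using irreducible_subset_of_closed_cover[OF assms(1,2) C(2,3)] C(2) assms(3) by auto
    then show ?thesis using anti[OF Z, of Z'] C(1) by blast
  qed
  then show "Z \<in> irreducible_components X"
    unfolding irreducible_components_def using Z irr assms(3) by blast
qed

text \<open>The witness is the sextuple whose points are distinct for distinct blocks.\<close>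
lemma diagonal_subset_imp:
  assumes "diagonal r \<subseteq> diagonal r'" "r \<circ> r = r"
  shows "r \<circ> r' = r"
proof -
  define \<iota> :: "letter \<Rightarrow> complex" where
    "\<iota> l = (case l of LA \<Rightarrow> 0 | LB \<Rightarrow> 1 | LC \<Rightarrow> 2 | LD \<Rightarrow> 3 | LE \<Rightarrow> 4 | LF \<Rightarrow> 5)" for l
  have inj: "\<iota> l = \<iota> m \<Longrightarrow> l = m" for l m by (cases l; cases m) (simp_all add: \<iota>_def)
  have "chart_map (\<lambda>_. False) (\<iota> \<circ> r) \<in> diagonal r"
    by (rule chart_map_in_diagonal_of_flat) (use assms(2) in \<open>simp_all add: flat_def fun_eq_iff\<close>)
  then have "chart_map (\<lambda>_. False) (\<iota> \<circ> r) \<in> diagonal r'" using assms(1) by blast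
  then have "\<iota> (r (r' l)) = \<iota> (r l)" for l
    by (simp add: chart_map_in_diagonal bracket_def chart_coord_def)
  then show ?thesis using inj by (auto simp: fun_eq_iff)
qed

lemma diagonal_antichain:
  assumes "r \<in> retractions" "r' \<in> retractions" "diagonal r \<subseteq> diagonal r'"
  shows "r = r'"
proof -
  have "r \<circ> r = r" using assms(1) by (auto simp: retractions_def fun_eq_iff)
  then have "\<forall>l. r (r' l) = r l" using diagonal_subset_imp[OF assms(3)] by (simp add: fun_eq_iff)
  then show ?thesis
    using assms(1,2) unfolding retractions_def letter_all insert_iff empty_iff simp_thms
    by (elim disjE) simp_all
qed

section \<open>The components of the scheme of base points\<close>

lemma irreducible_components_indeterminacy:
  "irreducible_components (subtopology zariski (support indeterminacy_scheme)) = diagonal ` retractions"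
proof -
  have fin: "finite (diagonal ` retractions)" by (simp add: retractions_def)
  have "zariski_closed (\<Union>(diagonal ` retractions))"
    using fin zariski_closed_diagonal by (intro zariski_closed_Union) auto
  then have S: "support indeterminacy_scheme = \<Union>(diagonal ` retractions)"
    unfolding indeterminacy_scheme_eq_reduced_structure by (rule support_reduced_structure)
  have sub: "\<Union>(diagonal ` retractions) \<inter> diagonal r = diagonal r" if "r \<in> retractions" for r
    using that by blast
  show ?thesis
    unfolding S
  proof (rule irreducible_components_of_cover[OF fin])
    show "topspace (subtopology zariski (\<Union> (diagonal ` retractions))) = \<Union> (diagonal ` retractions)"
      by (auto simp: topspace_zariski diagonal_def)
  next
    fix Z assume "Z \<in> diagonal ` retractions"
    then obtain r where r: "r \<in> retractions" "Z = diagonal r" by blast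
    then show "closedin (subtopology zariski (\<Union> (diagonal ` retractions))) Z"
      using zariski_closed_diagonal[of r] by (auto simp: closedin_subtopology closedin_zariski)
    show "irreducible_space (subtopology (subtopology zariski (\<Union> (diagonal ` retractions))) Z)"
      using irreducible_space_diagonal[of r] sub[OF r(1)] by (simp add: subtopology_subtopology r(2))
  next
    fix Z Z' assume "Z \<in> diagonal ` retractions" "Z' \<in> diagonal ` retractions" "Z \<subseteq> Z'"
    then show "Z = Z'" using diagonal_antichain by blast
  qed
qed

lemma card_diagonals: "card (diagonal ` retractions) = 6"
proof -
  have "inj_on diagonal retractions" using diagonal_antichain by (auto intro: inj_onI)
  then have "card (diagonal ` retractions) = card retractions" by (rule card_image)
  also have "\<dots> = 6"
    unfolding retractions_def by (simp add: fun_eq_iff letter_all card_insert_if)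
  finally show ?thesis .
qed

lemma polydiagonals_eq_diagonals:
  "polydiagonal ` {{{LA, LB, LC}, {LD}, {LE}, {LF}},
              {{LA}, {LB}, {LC}, {LD, LE, LF}},
              {{LA, LB}, {LC}, {LD}, {LE, LF}},
              {{LA}, {LB, LC}, {LD, LE}, {LF}},
              {{LA, LC}, {LB}, {LD, LF}, {LE}},
              {{LA, LF}, {LB, LE}, {LC, LD}}} = diagonal ` retractions"
proof -
  note simps = polydiagonal_def diagonal_def fun_eq_iff letter_all
  have "polydiagonal {{LA, LB, LC}, {LD}, {LE}, {LF}} = diagonal (id(LA := LC, LB := LC))"
    "polydiagonal {{LA}, {LB}, {LC}, {LD, LE, LF}} = diagonal (id(LE := LD, LF := LD))"
    "polydiagonal {{LA, LB}, {LC}, {LD}, {LE, LF}} = diagonal (id(LA := LB, LF := LE))"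
    "polydiagonal {{LA}, {LB, LC}, {LD, LE}, {LF}} = diagonal (id(LB := LC, LE := LD))"
    "polydiagonal {{LA, LC}, {LB}, {LD, LF}, {LE}} = diagonal (id(LC := LA, LD := LF))"
    "polydiagonal {{LA, LF}, {LB, LE}, {LC, LD}} = diagonal (id(LA := LF, LB := LE, LC := LD))"
    by (auto simp: simps)
  then show ?thesis unfolding retractions_def by (simp only: image_insert image_empty)
qed

theorem proposition2p1:
  shows "indeterminacy_scheme =
           scheme_union ((\<lambda>\<pi>. reduced_structure (polydiagonal \<pi>)) `
             {{{LA, LB, LC}, {LD}, {LE}, {LF}},
              {{LA}, {LB}, {LC}, {LD, LE, LF}},
              {{LA, LB}, {LC}, {LD}, {LE, LF}},
              {{LA}, {LB, LC}, {LD, LE}, {LF}},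
              {{LA, LC}, {LB}, {LD, LF}, {LE}},
              {{LA, LF}, {LB, LE}, {LC, LD}}})
         \<and> reduced_scheme indeterminacy_scheme
         \<and> card (irreducible_components (subtopology zariski (support indeterminacy_scheme))) = 6"
  unfolding image_image[symmetric, of reduced_structure polydiagonal] polydiagonals_eq_diagonals
    scheme_union_reduced_structure irreducible_components_indeterminacy card_diagonals
  unfolding indeterminacy_scheme_eq_reduced_structure
  by (simp add: reduced_scheme_reduced_structure)

end
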